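(* Let $G$ be a group of order $8$, let $\mathbb{F}$ be an algebraically closed field with $\operatorname{char}(\mathbb{F})\neq 2$, and let $n$ be a positive integer. The number of $n$ degree representations of $G$ over $\mathbb{F}$, up to isomorphism, is $\binom{n+7}{7}$ when $G$ is abelian, and $\sum_{s=0}^{\lfloor n/2\rfloor}\binom{n-2s+3}{3}$ otherwise.
   Context: An $n$ degree representation of $G$ over $\mathbb{F}$ is a homomorphism $\rho:G\to GL(\mathbb{V})$ where $\mathbb{V}$ is a vector space over $\mathbb{F}$ of dimension $n$. *)

theory Defs
  imports "HOL-Algebra.Bij" "Jordan_Normal_Form.VS_Connect"
begin

definition has_dim :: "('k, 'm) ring_scheme \<Rightarrow> nat \<Rightarrow> ('k, 'v) module \<Rightarrow> bool" where
  "has_dim K n V \<longleftrightarrow>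
     vectorspace K V \<and> vectorspace.fin_dim K V \<and> vectorspace.dim K V = n"

text \<open>Like \<^const>\<open>AutoGroup\<close>, the general linear group is cut out of
  \<^const>\<open>BijGroup\<close>, whose elements are extensional functions on the carrier.\<close>

definition GL :: "('k, 'm) ring_scheme \<Rightarrow> ('k, 'v) module \<Rightarrow> ('v \<Rightarrow> 'v) monoid" where
  "GL K V = BijGroup (carrier V)
     \<lparr>carrier := LinearCombinations.module_hom K V V \<inter> Bij (carrier V)\<rparr>"

definition reps :: "('k, 'm) ring_scheme \<Rightarrow> ('g, 'c) monoid_scheme \<Rightarrow> nat
    \<Rightarrow> (('k, 'v) module \<times> ('g \<Rightarrow> 'v \<Rightarrow> 'v)) set" where
  "reps K G n = {(V, \<rho>). has_dim K n V \<and> \<rho> \<in> hom G (GL K V)}"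

definition rep_iso :: "('k, 'm) ring_scheme \<Rightarrow> ('g, 'c) monoid_scheme \<Rightarrow> ('v \<Rightarrow> 'w)
    \<Rightarrow> ('k, 'v) module \<times> ('g \<Rightarrow> 'v \<Rightarrow> 'v) \<Rightarrow> ('k, 'w) module \<times> ('g \<Rightarrow> 'w \<Rightarrow> 'w) \<Rightarrow> bool" where
  "rep_iso K G T = (\<lambda>(V, \<rho>) (W, \<sigma>).
     T \<in> LinearCombinations.module_hom K V W \<and> bij_betw T (carrier V) (carrier W) \<and>
     (\<forall>g\<in>carrier G. \<forall>v\<in>carrier V. T (\<rho> g v) = \<sigma> g (T v)))"

text \<open>Elements of \<^term>\<open>reps K G n\<close> that differ only outside the relevant carriers, or in
  the unused multiplication and unit of the module record, are isomorphic, so the quotient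
  does not see them as different.\<close>

definition rep_rel :: "('k, 'm) ring_scheme \<Rightarrow> ('g, 'c) monoid_scheme \<Rightarrow> nat
    \<Rightarrow> ((('k, 'v) module \<times> ('g \<Rightarrow> 'v \<Rightarrow> 'v)) \<times> (('k, 'v) module \<times> ('g \<Rightarrow> 'v \<Rightarrow> 'v))) set" where
  "rep_rel K G n = {(X, Y). X \<in> reps K G n \<and> Y \<in> reps K G n \<and> (\<exists>T. rep_iso K G T X Y)}"

text \<open>The representation spaces range over all vector spaces whose vectors are taken from the
  type \<open>'v\<close>, which plays the role of the universe.  Some \<open>n\<close>-dimensional space must exist
  in \<open>'v\<close>, since otherwise there is nothing to count; every \<open>n\<close>-dimensional space over the
  field is then isomorphic to one in \<open>'v\<close>.  By the lemma below, \<open>'v = 'a vec\<close> is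
  large enough for all \<open>n\<close>.\<close>

definition rep_classes :: "'v itself \<Rightarrow> ('k, 'm) ring_scheme \<Rightarrow> ('g, 'c) monoid_scheme \<Rightarrow> nat
    \<Rightarrow> (('k, 'v) module \<times> ('g \<Rightarrow> 'v \<Rightarrow> 'v)) set set" where
  "rep_classes TYPE('v) K G n = reps K G n // rep_rel K G n"

lemma has_dim_module_vec: "has_dim class_ring n (module_vec TYPE('a :: field) n)"
proof -
  interpret vec_space "TYPE('a)" n .
  show ?thesis
    unfolding has_dim_def using vec_vs fin_dim dim_is_n by blast
qed

end

theory Submission
  imports Defs "HOL-Library.Function_Algebras" "HOL-Algebra.Multiplicative_Group"
begin

text \<open>
  After a choice of coordinates a representation becomes a family of total linear operators on
  sequences, the unit acting as truncation to the first \<open>n\<close> entries. Its isomorphism class is read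
  off from the dimensions of finitely many simultaneous eigenspaces.

  If \<open>G\<close> is abelian, extending characters along a chain of subgroups of index 2 (each step only needs
  square roots) shows that there are 8 characters and that their sum over any \<open>g \<noteq> 1\<close> vanishes;
  hence the averaging operators are projections onto the weight spaces and sum up to the identity. So
  an isomorphism class amounts to 8 multiplicities with sum \<open>n\<close>.

  If \<open>G\<close> is not abelian, it is generated by \<open>a\<close> and \<open>b\<close> with \<open>a\<^sup>4 = 1\<close>, \<open>b a = a\<^sup>3 b\<close> and
  \<open>b\<^sup>2 \<in> {1, a\<^sup>2}\<close>. The eigenspaces of \<open>a\<close> for \<open>\<plusminus>1\<close> split under \<open>b\<close> into the four
  one-dimensional types, and \<open>b\<close> exchanges the eigenspaces for \<open>\<plusminus>\<iota>\<close>, where \<open>\<iota>\<^sup>2 = -1\<close>. If the latter have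
  dimension \<open>s\<close>, the remaining four multiplicities sum to \<open>n - 2 s\<close>.
\<close>

section \<open>Linear algebra of projection systems\<close>

text \<open>Complete reducibility takes the form of explicit projections, whose denominators 8, 4
  and 2 are invertible because the characteristic is not 2. The given spaces have carriers inside an
  arbitrary type. They are therefore replaced by one ambient space, the sequences over the field,
  which serves all \<open>n\<close> at once and carries total linear maps. The price is that the
  unit of the group acts as a projection \<open>E\<close> instead of the identity, so inverses and
  decompositions are stated up to \<open>E\<close>. The dihedral and the quaternion group differ
  only in the square of \<open>b\<close>, and this square acts as a scalar: 1 on the eigenspaces of
  \<open>a\<close> for 1 and -1, and 1 or -1 on those for \<iota> and -\<iota>. One argument with
  this scalar as a parameter covers both groups. The binomial coefficients count the lists of 8 (or
  4) natural numbers with a given sum. Besides the invariance of the multiplicities this requires an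
  action for every such list: a diagonal one if the group is abelian, and otherwise one in which
  \<open>b\<close> also permutes coordinates in pairs.\<close>

locale linear_endo = vector_space scale
  for scale :: "'a::field \<Rightarrow> 'b::ab_group_add \<Rightarrow> 'b"
begin

abbreviation lin :: "('b \<Rightarrow> 'b) \<Rightarrow> bool" where
  "lin \<equiv> Vector_Spaces.linear scale scale"

lemma lin_iff: "lin f \<longleftrightarrow> (\<forall>x y. f (x + y) = f x + f y) \<and> (\<forall>c x. f (scale c x) = scale c (f x))"
  using Vector_Spaces.linear_iff[of scale scale f] vector_space_axioms by blast

lemma lin_add: "lin f \<Longrightarrow> f (x + y) = f x + f y"
  and lin_scale: "lin f \<Longrightarrow> f (scale c x) = scale c (f x)"
  by (simp_all add: lin_iff)

lemma lin_zero: "lin f \<Longrightarrow> f 0 = 0"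
  using lin_scale[of f 0 0] by simp

lemma lin_sum: "lin f \<Longrightarrow> f (\<Sum>i\<in>I. g i) = (\<Sum>i\<in>I. f (g i))"
  by (induction I rule: infinite_finite_induct) (simp_all add: lin_zero lin_add)

lemma lin_comp: "lin f \<Longrightarrow> lin g \<Longrightarrow> lin (\<lambda>x. f (g x))"
  by (simp add: lin_iff)

lemma lin_sum_fun: "(\<And>i. i \<in> I \<Longrightarrow> lin (f i)) \<Longrightarrow> lin (\<lambda>x. \<Sum>i\<in>I. f i x)"
  by (simp add: lin_iff sum.distrib scale_sum_right)

lemma lin_scale_fun: "lin f \<Longrightarrow> lin (\<lambda>x. scale c (f x))"
  by (simp add: lin_iff scale_right_distrib mult.commute)

lemma lin_add_fun: "lin f \<Longrightarrow> lin g \<Longrightarrow> lin (\<lambda>x. f x + g x)"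
  by (simp add: lin_iff scale_right_distrib algebra_simps)

lemma subspace_eigen: "lin f \<Longrightarrow> subspace {v. f v = scale c v}"
  by (simp add: subspace_def lin_zero lin_add lin_scale scale_right_distrib mult.commute)

text \<open>Bases of equal size are matched. The finite spanning set is essential because
  \<open>dim\<close> is a cardinality, hence 0 for every infinite basis. Both maps are total and
  linear, so that they can later be composed with projections.\<close>

lemma subspaces_isomorphic:
  assumes "subspace S" "subspace T" "dim S = dim T"
    and "finite F" "S \<subseteq> span F" "T \<subseteq> span F"
  obtains f g where "lin f" "lin g" "\<And>x. x \<in> S \<Longrightarrow> f x \<in> T" "\<And>y. y \<in> T \<Longrightarrow> g y \<in> S"
    "\<And>x. x \<in> S \<Longrightarrow> g (f x) = x" "\<And>y. y \<in> T \<Longrightarrow> f (g y) = y"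
proof -
  interpret vector_space_pair scale scale by unfold_locales
  obtain B where B: "B \<subseteq> S" "independent B" "S \<subseteq> span B" "card B = dim S"
    using basis_exists by blast
  obtain C where C: "C \<subseteq> T" "independent C" "T \<subseteq> span C" "card C = dim T"
    using basis_exists by blast
  have "finite B" "finite C"
    using independent_span_bound[OF assms(4) B(2)] independent_span_bound[OF assms(4) C(2)]
      B(1) C(1) assms(5,6) by auto
  then obtain f where f: "lin f" "f ` S = T" "inj_on f S"
    using finite_basis_to_basis_subspace_isomorphism[OF assms(1-3) _ B _ C] by blast
  obtain g where g: "range g \<subseteq> S" "lin g" "\<And>v. v \<in> S \<Longrightarrow> g (f v) = v"
    using linear_exists_left_inverse_on[OF f(1) assms(1) f(3)] by blast
  show thesis
    by (rule that[of f g]) (use f g in auto)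
qed

text \<open>The linear map \<open>f\<close> carries a basis of \<open>S\<close> to a basis of
  \<open>T\<close>; \<open>g\<close> witnesses bijectivity.\<close>

lemma dim_eq_if_inverse:
  assumes "lin f" "subspace S" "\<And>x. x \<in> S \<Longrightarrow> f x \<in> T" "\<And>y. y \<in> T \<Longrightarrow> g y \<in> S"
    "\<And>x. x \<in> S \<Longrightarrow> g (f x) = x" "\<And>y. y \<in> T \<Longrightarrow> f (g y) = y"
  shows "dim S = dim T"
proof -
  interpret vector_space_pair scale scale by unfold_locales
  obtain B where B: "B \<subseteq> S" "independent B" "S \<subseteq> span B" "card B = dim S"
    using basis_exists by blast
  have SB: "span B = S"
    using B assms(2) span_subspace by blast
  have inj: "inj_on f S"
    by (rule inj_on_inverseI[of _ g]) (use assms in auto)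
  have T: "T = f ` S"
    using assms(3,4,6) by (auto simp: image_iff) metis
  show ?thesis
  proof (rule sym, rule dim_unique)
    show "f ` B \<subseteq> T" using B T by blast
    show "T \<subseteq> span (f ` B)"
      using linear_span_image[OF assms(1), of B] SB T by simp
    show "independent (f ` B)"
      using linear_independent_injective_image[OF assms(1) B(2)] inj SB by simp
    show "card (f ` B) = dim S"
      using B inj by (metis card_image inj_on_subset)
  qed
qed

text \<open>This is an internal direct sum decomposition of the range of \<open>E\<close>, presented
  by its projections. These are total maps that sum to \<open>E\<close> and not to the identity; the
  conditions make \<open>E\<close> itself a linear projection.\<close>

definition projection_system :: "('b \<Rightarrow> 'b) \<Rightarrow> 'i set \<Rightarrow> ('i \<Rightarrow> 'b set) \<Rightarrow> ('i \<Rightarrow> 'b \<Rightarrow> 'b) \<Rightarrow> bool" where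
  "projection_system E I W P \<longleftrightarrow> finite I \<and>
    (\<forall>i\<in>I. subspace (W i) \<and> lin (P i) \<and> (\<forall>v. P i v \<in> W i) \<and> (\<forall>v\<in>W i. P i v = v)) \<and>
    (\<forall>i\<in>I. \<forall>j\<in>I. i \<noteq> j \<longrightarrow> (\<forall>v\<in>W j. P i v = 0)) \<and>
    (\<forall>v. (\<Sum>i\<in>I. P i v) = E v)"

context
  fixes E and I :: "'i set" and W P
  assumes sys: "projection_system E I W P"
begin

lemma projection_systemD:
  shows "finite I" "i \<in> I \<Longrightarrow> subspace (W i)" "i \<in> I \<Longrightarrow> lin (P i)" "i \<in> I \<Longrightarrow> P i v \<in> W i"
    "i \<in> I \<Longrightarrow> v \<in> W i \<Longrightarrow> P i v = v" "i \<in> I \<Longrightarrow> j \<in> I \<Longrightarrow> i \<noteq> j \<Longrightarrow> v \<in> W j \<Longrightarrow> P i v = 0"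
    "(\<Sum>i\<in>I. P i v) = E v"
  using sys unfolding projection_system_def by blast+

lemma projection_system_sum:
  assumes "i \<in> I" "v \<in> W i" "\<And>j. j \<in> I \<Longrightarrow> lin (t j)"
  shows "(\<Sum>j\<in>I. t j (P j v)) = t i v"
proof -
  have "(\<Sum>j\<in>I. t j (P j v)) = (\<Sum>j\<in>I. if j = i then t i v else 0)"
    by (rule sum.cong) (use assms projection_systemD in \<open>auto simp: lin_zero\<close>)
  then show ?thesis using assms projection_systemD(1) by simp
qed

lemma projection_system_fix: "i \<in> I \<Longrightarrow> v \<in> W i \<Longrightarrow> E v = v"
  using projection_system_sum[of i v "\<lambda>_ x. x"] lin_iff[of "\<lambda>x. x"]
  by (simp add: projection_systemD(7))

lemma projection_system_lin: "lin E"
  using lin_sum_fun[of I P] projection_systemD by simp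

text \<open>Decomposing \<open>E v\<close> into blocks reduces an identity of linear maps to the
  blocks. It is claimed after \<open>E\<close> only, since the blocks say nothing about vectors off
  its range.\<close>

lemma projection_system_eqI:
  assumes "lin f" "lin g" "\<And>i v. i \<in> I \<Longrightarrow> v \<in> W i \<Longrightarrow> f v = g v"
  shows "f (E v) = g (E v)"
proof -
  have "f (E v) = (\<Sum>i\<in>I. f (P i v))" "g (E v) = (\<Sum>i\<in>I. g (P i v))"
    using assms(1,2) projection_systemD(7)[of v] lin_sum by metis+
  then show ?thesis using assms(3) projection_systemD(4) by simp
qed

text \<open>The union of bases of the blocks is a basis of the range: applying \<open>P i\<close> to
  a linear relation erases all terms except those from block \<open>i\<close>. Cardinalities add
  because a vector common to two blocks would be both fixed and killed by a projection, hence
  0.\<close>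

lemma dim_projection_system:
  assumes "finite F" "range E \<subseteq> span F"
  shows "dim (range E) = (\<Sum>i\<in>I. dim (W i))"
proof -
  have "\<forall>i. \<exists>B. B \<subseteq> W i \<and> independent B \<and> W i \<subseteq> span B \<and> card B = dim (W i)"
    using basis_exists by metis
  then obtain B where B: "\<And>i. B i \<subseteq> W i" "\<And>i. independent (B i)" "\<And>i. W i \<subseteq> span (B i)"
    "\<And>i. card (B i) = dim (W i)"
    by metis
  have WE: "W i \<subseteq> range E" if "i \<in> I" for i
    using projection_system_fix[OF that] by (metis rangeI subsetI)
  have finB: "finite (B i)" if "i \<in> I" for i
    using independent_span_bound[OF assms(1) B(2)] B(1)[of i] WE[OF that] assms(2) by blast
  have disj: "B i \<inter> B j = {}" if "i \<in> I" "j \<in> I" "i \<noteq> j" for i j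
  proof (rule ccontr)
    assume "B i \<inter> B j \<noteq> {}"
    then obtain x where x: "x \<in> B i" "x \<in> B j" by blast
    then have "x \<in> W i" "x \<in> W j" using B(1) by blast+
    then have "x = 0"
      using projection_systemD(5)[OF that(1)] projection_systemD(6)[OF that] by metis
    then show False using x B(2) dependent_zero by blast
  qed
  let ?B = "\<Union>i\<in>I. B i"
  have fin: "finite ?B" using projection_systemD(1) finB by blast
  have "independent ?B"
  proof (rule independent_if_scalars_zero[OF fin])
    fix f x
    assume sum0: "(\<Sum>x\<in>?B. scale (f x) x) = 0" and "x \<in> ?B"
    then obtain i where i: "i \<in> I" "x \<in> B i" by blast
    have "0 = P i (\<Sum>x\<in>?B. scale (f x) x)"
      using sum0 lin_zero projection_systemD(3) i by simp
    also have "\<dots> = (\<Sum>x\<in>?B. scale (f x) (P i x))"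
      using projection_systemD(3) i by (simp add: lin_sum lin_scale)
    also have "\<dots> = (\<Sum>x\<in>B i. scale (f x) x)"
    proof (rule sum.mono_neutral_cong_right[OF fin])
      show "B i \<subseteq> ?B" using i by blast
      show "\<forall>y\<in>?B - B i. scale (f y) (P i y) = 0"
        using projection_systemD(6)[OF i(1)] B(1) by fastforce
      show "\<And>y. y \<in> B i \<Longrightarrow> scale (f y) (P i y) = scale (f y) y"
        using projection_systemD(5) i B(1) by fastforce
    qed
    finally show "f x = 0"
      using independentD[OF B(2) finB subset_refl, of i f x] i by simp
  qed
  moreover have "?B \<subseteq> range E" using B(1) WE by blast
  moreover have "range E \<subseteq> span ?B"
  proof
    fix w assume "w \<in> range E"
    then obtain v where "w = (\<Sum>i\<in>I. P i v)" using projection_systemD(7) by auto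
    moreover have "P i v \<in> span ?B" if "i \<in> I" for i
      using projection_systemD(4)[OF that] B(3)[of i] span_mono[of "B i" ?B] that by blast
    ultimately show "w \<in> span ?B" by (simp add: span_sum)
  qed
  ultimately have "dim (range E) = card ?B" by (metis dim_unique)
  also have "\<dots> = (\<Sum>i\<in>I. card (B i))"
    by (rule card_UN_disjoint) (use projection_systemD(1) finB disj in auto)
  finally show ?thesis using B(4) by simp
qed

end

text \<open>The map \<open>T\<close> sums the pieces \<open>t i\<close> after the projections
  \<open>P i\<close>, and \<open>S\<close> is built likewise from \<open>s i\<close> and
  \<open>P' i\<close>. Both decompositions belong to the same \<open>E\<close>, so both composites
  are \<open>E\<close>.\<close>

lemma projection_system_glue:
  assumes sys: "projection_system E I W P" "projection_system E I W' P'"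
    and t: "\<And>i. i \<in> I \<Longrightarrow> lin (t i)" "\<And>i v. i \<in> I \<Longrightarrow> v \<in> W i \<Longrightarrow> t i v \<in> W' i"
    and s: "\<And>i. i \<in> I \<Longrightarrow> lin (s i)" "\<And>i v. i \<in> I \<Longrightarrow> v \<in> W' i \<Longrightarrow> s i v \<in> W i"
    and st: "\<And>i v. i \<in> I \<Longrightarrow> v \<in> W i \<Longrightarrow> s i (t i v) = v"
    and ts: "\<And>i v. i \<in> I \<Longrightarrow> v \<in> W' i \<Longrightarrow> t i (s i v) = v"
  obtains T S where "lin T" "lin S" "\<And>v. S (T v) = E v" "\<And>v. T (S v) = E v"
    "\<And>i v. i \<in> I \<Longrightarrow> v \<in> W i \<Longrightarrow> T v = t i v" "\<And>v. T (E v) = T v" "\<And>v. E (T v) = T v"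
proof
  let ?T = "\<lambda>v. \<Sum>i\<in>I. t i (P i v)" and ?S = "\<lambda>v. \<Sum>i\<in>I. s i (P' i v)"
  note D = projection_systemD[OF sys(1)] and D' = projection_systemD[OF sys(2)]
  show linT: "lin ?T" by (rule lin_sum_fun) (rule lin_comp, use D t in auto)
  show linS: "lin ?S" by (rule lin_sum_fun) (rule lin_comp, use D' s in auto)
  have T: "?T v = t i v" if "i \<in> I" "v \<in> W i" for i v
    using projection_system_sum[OF sys(1)] that t by blast
  then show "\<And>i v. i \<in> I \<Longrightarrow> v \<in> W i \<Longrightarrow> ?T v = t i v" .
  have S: "?S v = s i v" if "i \<in> I" "v \<in> W' i" for i v
    using projection_system_sum[OF sys(2)] that s by blast
  show "?S (?T v) = E v" for v
  proof -
    have "?S (?T v) = (\<Sum>i\<in>I. ?S (t i (P i v)))"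
      by (rule lin_sum[OF linS])
    also have "\<dots> = (\<Sum>i\<in>I. P i v)"
      by (rule sum.cong) (use S t st D in auto)
    finally show ?thesis using D by simp
  qed
  show "?T (?S v) = E v" for v
  proof -
    have "?T (?S v) = (\<Sum>i\<in>I. ?T (s i (P' i v)))"
      by (rule lin_sum[OF linT])
    also have "\<dots> = (\<Sum>i\<in>I. P' i v)"
      by (rule sum.cong) (use T s ts D' in auto)
    finally show ?thesis using D' by simp
  qed
  show "?T (E v) = ?T v" for v
  proof -
    have "?T (E v) = (\<Sum>i\<in>I. ?T (P i v))"
      using lin_sum[OF linT, of "\<lambda>i. P i v" I] D(7) by simp
    also have "\<dots> = ?T v"
      by (rule sum.cong) (use T D in auto)
    finally show ?thesis .
  qed
  show "E (?T v) = ?T v" for v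
  proof -
    have "E (?T v) = (\<Sum>i\<in>I. E (t i (P i v)))"
      by (rule lin_sum[OF projection_system_lin[OF sys(1)]])
    also have "\<dots> = ?T v"
      by (rule sum.cong) (use projection_system_fix[OF sys(2)] t D in auto)
    finally show ?thesis .
  qed
qed

end

section \<open>Characters of abelian 2-groups\<close>

text \<open>Values lie in the field and not in its unit group; the condition at the unit excludes
  the zero map, and then all values on a subgroup are nonzero. Extensionality makes each character
  of \<open>H\<close> a single function, so that characters can be counted.\<close>

definition characters :: "('g, 'c) monoid_scheme \<Rightarrow> 'g set \<Rightarrow> ('g \<Rightarrow> 'a::field) set" where
  "characters G H = {\<chi> \<in> extensional H. \<chi> \<one>\<^bsub>G\<^esub> = 1 \<and> (\<forall>x\<in>H. \<forall>y\<in>H. \<chi> (x \<otimes>\<^bsub>G\<^esub> y) = \<chi> x * \<chi> y)}"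

text \<open>The number of characters is recorded separately, since in positive characteristic the sum at \<open>1\<close>
  only determines it modulo the characteristic.\<close>

definition dual_orthogonal :: "'a::field itself \<Rightarrow> ('g, 'c) monoid_scheme \<Rightarrow> 'g set \<Rightarrow> bool" where
  "dual_orthogonal TYPE('a) G H \<longleftrightarrow> finite (characters G H :: ('g \<Rightarrow> 'a) set) \<and>
    card (characters G H :: ('g \<Rightarrow> 'a) set) = card H \<and>
    (\<forall>h\<in>H. (\<Sum>\<chi>\<in>characters G H. \<chi> h) = (if h = \<one>\<^bsub>G\<^esub> then of_nat (card H) else (0::'a)))"

lemma charactersD:
  assumes "\<chi> \<in> characters G H"
  shows "\<chi> \<in> extensional H" "\<chi> \<one>\<^bsub>G\<^esub> = 1" "x \<in> H \<Longrightarrow> y \<in> H \<Longrightarrow> \<chi> (x \<otimes>\<^bsub>G\<^esub> y) = \<chi> x * \<chi> y"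
  using assms by (auto simp: characters_def)

lemma (in group) character_nonzero:
  assumes "\<chi> \<in> characters G H" "subgroup H G" "x \<in> H"
  shows "\<chi> x \<noteq> 0"
proof
  assume "\<chi> x = 0"
  then have "\<chi> (x \<otimes> inv x) = 0"
    using charactersD(3)[OF assms(1,3)] subgroup.m_inv_closed[OF assms(2,3)] by simp
  then show False
    using charactersD(2)[OF assms(1)] assms(2,3) by (simp add: subgroup.mem_carrier)
qed

section \<open>Adjoining to a subgroup an element whose square lies in it\<close>

context comm_group
begin

context
  fixes H g
  assumes H: "subgroup H G" and fin: "finite H" and g: "g \<in> carrier G" "g \<notin> H" "g \<otimes> g \<in> H"
begin

lemma extended_subgroup_carrier: "x \<in> H \<Longrightarrow> x \<in> carrier G"
  by (rule subgroup.mem_carrier[OF H])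

lemma extended_subgroup_closed: "x \<in> H \<Longrightarrow> y \<in> H \<Longrightarrow> x \<otimes> y \<in> H" "x \<in> H \<Longrightarrow> inv x \<in> H" "\<one> \<in> H"
  using subgroup.m_closed[OF H] subgroup.m_inv_closed[OF H] subgroup.one_closed[OF H] by simp_all

lemma extending_coset_disjoint: "x \<in> H \<Longrightarrow> g \<otimes> x \<notin> H"
proof
  assume x: "x \<in> H" and "g \<otimes> x \<in> H"
  then have "g \<otimes> x \<otimes> inv x \<in> H" using extended_subgroup_closed by blast
  then show False using g x extended_subgroup_carrier by (simp add: m_assoc)
qed

lemma quadratic_extension_cases:
  assumes "x \<in> H \<union> (\<otimes>) g ` H"
  obtains "x \<in> H" | h where "h \<in> H" "x = g \<otimes> h"
  using assms by (elim UnE imageE)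

lemma quadratic_extension_mult:
  assumes "x \<in> H" "y \<in> H"
  shows "x \<otimes> (g \<otimes> y) = g \<otimes> (x \<otimes> y)" "g \<otimes> x \<otimes> y = g \<otimes> (x \<otimes> y)"
    "g \<otimes> x \<otimes> (g \<otimes> y) = g \<otimes> g \<otimes> (x \<otimes> y)"
proof -
  have "x \<in> carrier G" "y \<in> carrier G" using assms extended_subgroup_carrier by simp_all
  then show "x \<otimes> (g \<otimes> y) = g \<otimes> (x \<otimes> y)" "g \<otimes> x \<otimes> y = g \<otimes> (x \<otimes> y)"
    "g \<otimes> x \<otimes> (g \<otimes> y) = g \<otimes> g \<otimes> (x \<otimes> y)"
    using g(1) by (simp_all add: m_ac)
qed

lemma subgroup_quadratic_extension: "subgroup (H \<union> (\<otimes>) g ` H) G"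
proof (rule subgroupI)
  show "H \<union> (\<otimes>) g ` H \<subseteq> carrier G"
  proof
    fix x assume "x \<in> H \<union> (\<otimes>) g ` H"
    then show "x \<in> carrier G"
      by (cases rule: quadratic_extension_cases) (simp_all add: extended_subgroup_carrier g(1))
  qed
  show "H \<union> (\<otimes>) g ` H \<noteq> {}" using extended_subgroup_closed by blast
  show "inv a \<in> H \<union> (\<otimes>) g ` H" if "a \<in> H \<union> (\<otimes>) g ` H" for a
    using that
  proof (cases rule: quadratic_extension_cases)
    case 1
    then show ?thesis using extended_subgroup_closed by blast
  next
    case (2 h)
    have h: "h \<in> carrier G" by (rule extended_subgroup_carrier[OF 2(1)])
    \<comment> \<open>The inverse of \<open>g\<close> is
      \<open>g \<otimes> inv (g \<otimes> g)\<close>, which exhibits the inverse of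
      \<open>g \<otimes> h\<close> as an element of the coset of \<open>g\<close>.\<close>
    have "g \<otimes> (inv h \<otimes> inv (g \<otimes> g)) \<otimes> (g \<otimes> h) = (g \<otimes> g \<otimes> inv (g \<otimes> g)) \<otimes> (h \<otimes> inv h)"
      using g(1) h by (simp only: m_ac m_closed inv_closed)
    also have "\<dots> = \<one>"
      using r_inv[of "g \<otimes> g"] r_inv[OF h] g(1) by (simp only: m_closed r_one one_closed)
    finally have "g \<otimes> (inv h \<otimes> inv (g \<otimes> g)) = inv a"
      using inv_equality g(1) h 2(2) by simp
    moreover have "inv h \<otimes> inv (g \<otimes> g) \<in> H"
      by (intro extended_subgroup_closed g 2)
    ultimately show ?thesis by (metis UnI2 imageI)
  qed
  show "a \<otimes> b \<in> H \<union> (\<otimes>) g ` H" if "a \<in> H \<union> (\<otimes>) g ` H" "b \<in> H \<union> (\<otimes>) g ` H" for a b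
    using that(1)
  proof (cases rule: quadratic_extension_cases)
    case a: 1
    show ?thesis using that(2)
      by (cases rule: quadratic_extension_cases)
        (simp_all add: a extended_subgroup_closed quadratic_extension_mult)
  next
    case (2 h)
    show ?thesis using that(2)
      by (cases rule: quadratic_extension_cases)
        (simp_all add: 2 g(3) extended_subgroup_closed quadratic_extension_mult)
  qed
qed

lemma card_quadratic_extension: "card (H \<union> (\<otimes>) g ` H) = 2 * card H"
proof -
  have "inj_on ((\<otimes>) g) H" using g extended_subgroup_carrier by (auto intro: inj_onI)
  then show ?thesis
    using fin extending_coset_disjoint by (subst card_Un_disjoint) (auto simp: card_image)
qed

text \<open>A character \<chi> of \<open>H\<close> extends in exactly two ways: its value at
  \<open>g\<close> must be a square root of \<open>\<chi> (g \<otimes> g)\<close>, and the two roots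
  differ because this value is nonzero and 2 is nonzero. So the number of characters doubles along
  with the subgroup. The values of the two extensions add up to \<open>2 * \<chi> x\<close> for
  \<open>x\<close> in \<open>H\<close> and cancel on the coset of \<open>g\<close>, which preserves
  orthogonality.\<close>

lemma dual_orthogonal_step:
  assumes two: "(2::'k) \<noteq> 0" and sq: "\<And>x::'k. \<exists>y. y * y = x"
    and dual: "dual_orthogonal TYPE('k::field) G H"
  shows "dual_orthogonal TYPE('k) G (H \<union> (\<otimes>) g ` H)"
proof -
  let ?H = "H \<union> (\<otimes>) g ` H"
  let ?K = "characters G H :: ('a \<Rightarrow> 'k) set" and ?K' = "characters G ?H :: ('a \<Rightarrow> 'k) set"
  define c where "c = (\<lambda>\<chi>::'a \<Rightarrow> 'k. SOME y. y * y = \<chi> (g \<otimes> g))"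
  have c: "c \<chi> * c \<chi> = \<chi> (g \<otimes> g)" for \<chi>
    unfolding c_def using sq by (rule someI_ex)
  have c0: "c \<chi> \<noteq> 0" if "\<chi> \<in> ?K" for \<chi>
    using c[of \<chi>] character_nonzero[OF that H g(3)] by auto
  \<comment> \<open>The root \<open>c \<chi>\<close> is fixed once and for all, and the sign
    \<epsilon> ranges over both extensions; \<open>inv g \<otimes> x\<close> recovers
    \<open>h\<close> from \<open>x = g \<otimes> h\<close>.\<close>
  define f where "f = (\<lambda>(\<chi>::'a \<Rightarrow> 'k, \<epsilon>::'k). \<lambda>x\<in>?H. if x \<in> H then \<chi> x else \<epsilon> * c \<chi> * \<chi> (inv g \<otimes> x))"
  have f1: "f (\<chi>, \<epsilon>) x = \<chi> x" if "x \<in> H" for \<chi> \<epsilon> x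
    using that by (simp add: f_def)
  have f2: "f (\<chi>, \<epsilon>) (g \<otimes> x) = \<epsilon> * c \<chi> * \<chi> x" if "x \<in> H" for \<chi> \<epsilon> x
    using that g(1) extending_coset_disjoint[OF that] extended_subgroup_carrier[OF that] by (simp add: f_def m_assoc[symmetric])
  have neq: "(1::'k) \<noteq> -1" using two by (metis add.right_inverse one_add_one)
  have f_mem: "f (\<chi>, \<epsilon>) \<in> ?K'" if \<chi>: "\<chi> \<in> ?K" and \<epsilon>: "\<epsilon> \<in> {1, -1}" for \<chi> \<epsilon>
  proof -
    \<comment> \<open>The product of two elements of the coset returns to \<open>H\<close>, where
      the sign must disappear: it occurs squared.\<close>
    have *: "(\<epsilon> * c \<chi> * a) * (\<epsilon> * c \<chi> * b) = \<chi> (g \<otimes> g) * (a * b)" for a b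
      using \<epsilon> c[of \<chi>, symmetric] by (auto simp: algebra_simps)
    have "f (\<chi>, \<epsilon>) (x \<otimes> y) = f (\<chi>, \<epsilon>) x * f (\<chi>, \<epsilon>) y" if "x \<in> ?H" "y \<in> ?H" for x y
      using that(1)
    proof (cases rule: quadratic_extension_cases)
      case x: 1
      show ?thesis using that(2)
        by (cases rule: quadratic_extension_cases)
          (simp_all add: x extended_subgroup_closed charactersD(3)[OF \<chi>] quadratic_extension_mult f1 f2)
    next
      case (2 h)
      show ?thesis using that(2)
        by (cases rule: quadratic_extension_cases)
          (simp_all add: 2 g(3) * extended_subgroup_closed charactersD(3)[OF \<chi>] quadratic_extension_mult f1 f2)
    qed
    moreover have "f (\<chi>, \<epsilon>) \<one> = 1" using f1 extended_subgroup_closed charactersD(2)[OF \<chi>] by simp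
    moreover have "f (\<chi>, \<epsilon>) \<in> extensional ?H" by (simp add: f_def)
    ultimately show ?thesis by (simp add: characters_def)
  qed
  have inj: "inj_on f (?K \<times> {1, -1})"
  proof (rule inj_onI)
    fix p q assume p: "p \<in> ?K \<times> {1, -1}" and q: "q \<in> ?K \<times> {1, -1}" and eq: "f p = f q"
    obtain \<chi> \<epsilon> \<psi> \<delta> where pq: "p = (\<chi>, \<epsilon>)" "q = (\<psi>, \<delta>)" by fastforce
    have "\<chi> x = \<psi> x" for x
    proof (cases "x \<in> H")
      case True
      then show ?thesis using eq f1 pq by metis
    next
      case False
      then show ?thesis using p q pq charactersD(1)
        by (metis SigmaD1 extensional_arb)
    qed
    then have "\<chi> = \<psi>" by blast
    moreover have "\<chi> \<one> = 1" "\<psi> \<one> = 1" using charactersD(2) p q pq by blast+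
    then have "\<epsilon> * c \<chi> = \<delta> * c \<psi>"
      using eq pq f2[OF extended_subgroup_closed(3), of \<chi> \<epsilon>] f2[OF extended_subgroup_closed(3), of \<psi> \<delta>]  by simp
    ultimately show "p = q" using pq c0 p by auto
  qed
  have surj: "\<exists>p \<in> ?K \<times> {1, -1}. \<psi> = f p" if \<psi>: "\<psi> \<in> ?K'" for \<psi>
  proof -
    define \<chi> where "\<chi> = restrict \<psi> H"
    have \<chi>: "\<chi> \<in> ?K"
      using \<psi> extended_subgroup_closed unfolding characters_def by (auto simp: \<chi>_def)
    have gH: "g \<in> ?H" using extended_subgroup_closed(3) g(1) by force
    have "\<psi> g * \<psi> g = \<psi> (g \<otimes> g)" using charactersD(3)[OF \<psi> gH gH] by simp
    also have "\<dots> = c \<chi> * c \<chi>" using g c by (simp add: \<chi>_def)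
    finally have "\<psi> g = c \<chi> \<or> \<psi> g = - c \<chi>" by (simp add: square_eq_iff)
    then obtain \<epsilon> where \<epsilon>: "\<epsilon> \<in> {1, -1}" "\<psi> g = \<epsilon> * c \<chi>" by force
    have "\<psi> x = f (\<chi>, \<epsilon>) x" for x
    proof (cases "x \<in> ?H")
      case True
      then show ?thesis
      proof (cases rule: quadratic_extension_cases)
        case 1
        then show ?thesis by (simp add: f1) (simp add: \<chi>_def)
      next
        case (2 h)
        then show ?thesis using charactersD(3)[OF \<psi> gH, of h] \<epsilon> by (simp add: f2) (simp add: \<chi>_def)
      qed
    next
      case False
      then show ?thesis using charactersD(1)[OF \<psi>] by (auto simp: f_def extensional_def)
    qed
    then show ?thesis using \<chi> \<epsilon> by blast
  qed
  have bij: "bij_betw f (?K \<times> {1, -1}) ?K'"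
    unfolding bij_betw_def using inj f_mem surj by blast
  have finK: "finite ?K" and cardK: "card ?K = card H"
    and sumK: "\<And>h. h \<in> H \<Longrightarrow> (\<Sum>\<chi>\<in>?K. \<chi> h) = (if h = \<one> then of_nat (card H) else 0)"
    using dual by (auto simp: dual_orthogonal_def)
  have sum: "(\<Sum>\<chi>\<in>?K'. \<chi> x) = (\<Sum>\<chi>\<in>?K. f (\<chi>, 1) x + f (\<chi>, -1) x)" for x
  proof -
    have "(\<Sum>\<chi>\<in>?K'. \<chi> x) = (\<Sum>p\<in>?K \<times> {1, -1}. f p x)"
      using sum.reindex_bij_betw[OF bij, of "\<lambda>\<chi>. \<chi> x"] by simp
    also have "\<dots> = (\<Sum>\<chi>\<in>?K. \<Sum>\<epsilon>\<in>{1,-1}. f (\<chi>, \<epsilon>) x)"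
      by (simp add: sum.cartesian_product)
    finally show ?thesis using neq by simp
  qed
  have "(\<Sum>\<chi>\<in>?K'. \<chi> x) = (if x = \<one> then of_nat (card ?H) else 0)" if "x \<in> ?H" for x
    using that
  proof (cases rule: quadratic_extension_cases)
    case 1
    then show ?thesis
      using sumK[OF 1] by (simp add: sum f1 card_quadratic_extension flip: mult_2 sum_distrib_left)
  next
    case (2 h)
    then have "x \<noteq> \<one>" using extending_coset_disjoint extended_subgroup_closed(3) by metis
    then show ?thesis using 2 by (simp add: sum f2)
  qed
  moreover have "card ?K' = card ?H"
    using bij_betw_same_card[OF bij] neq by (simp add: card_cartesian_product cardK card_quadratic_extension)
  moreover have "finite ?K'" using bij finK bij_betw_finite by blast
  ultimately show ?thesis by (simp add: dual_orthogonal_def)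
qed

end

lemma dual_orthogonal_one: "dual_orthogonal TYPE('k::field) G {\<one>}"
proof -
  have "characters G {\<one>} = {(\<lambda>x\<in>{\<one>}. 1) :: 'a \<Rightarrow> 'k}"
    by (auto simp: characters_def extensional_def fun_eq_iff)
  then show ?thesis by (simp add: dual_orthogonal_def)
qed

text \<open>Instead of building a chain of subgroups, a largest subgroup with the property is taken.
  If it missed an element, the step above would double it.\<close>

lemma dual_orthogonal_2_group:
  assumes two: "(2::'k::field) \<noteq> 0" and sq: "\<And>x::'k. \<exists>y. y * y = x"
    and ord: "Coset.order G = 2 ^ m"
  shows "dual_orthogonal TYPE('k) G (carrier G)"
proof -
  have fin: "finite (carrier G)"
    using ord order_gt_0_iff_finite by simp
  let ?S = "{H. subgroup H G \<and> dual_orthogonal TYPE('k) G H}"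
  have "?S \<noteq> {}" using dual_orthogonal_one triv_subgroup by blast
  moreover have "finite ?S"
    by (rule finite_subset[of _ "Pow (carrier G)"]) (use fin subgroup.subset in auto)
  ultimately obtain H where "H \<in> ?S" and "Max (card ` ?S) = card H"
    using obtains_MAX[of ?S card] by metis
  then have H: "subgroup H G" "dual_orthogonal TYPE('k) G H" by simp_all
  from \<open>Max (card ` ?S) = card H\<close> \<open>finite ?S\<close> have max: "card K \<le> card H" if "K \<in> ?S" for K
    using that by (metis (no_types, lifting) Max_ge finite_imageI imageI)
  have finH: "finite H" using fin H(1) finite_subset subgroup.subset by blast
  have "carrier G \<subseteq> H"
  proof (rule ccontr)
    assume "\<not> carrier G \<subseteq> H"
    then obtain x where x: "x \<in> carrier G" "x \<notin> H" by blast
    \<comment> \<open>Repeated squaring of \<open>x\<close> ends at \<one>, so it enters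
      \<open>H\<close>; the last power before that lies outside \<open>H\<close> and has its square
      in \<open>H\<close>. As \<open>x\<close> itself is outside, the least exponent is
      positive.\<close>
    define j where "j = (LEAST j. x [^] (2 ^ j :: nat) \<in> H)"
    have ex: "x [^] (2 ^ m :: nat) \<in> H"
      using pow_order_eq_1[OF x(1)] ord subgroup.one_closed[OF H(1)] by simp
    then have j: "x [^] (2 ^ j :: nat) \<in> H" unfolding j_def by (rule LeastI)
    then obtain i where i: "j = Suc i" using x by (cases j) auto
    define g where "g = x [^] (2 ^ i :: nat)"
    have "g \<notin> H" using not_less_Least[of i "\<lambda>j. x [^] (2 ^ j :: nat) \<in> H"] i j_def g_def by auto
    moreover have "g \<otimes> g \<in> H"
      using j i x by (simp add: g_def nat_pow_mult mult_2)
    moreover have "g \<in> carrier G" using x g_def by simp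
    ultimately have "H \<union> (\<otimes>) g ` H \<in> ?S" "card (H \<union> (\<otimes>) g ` H) = 2 * card H"
      using subgroup_quadratic_extension dual_orthogonal_step[OF _ _ _ _ _ two sq] card_quadratic_extension
        H finH by auto
    then have "card H = 0" using max by fastforce
    then show False using finH H(1) subgroup.one_closed by fastforce
  qed
  then show ?thesis using H subgroup.subset by (metis subset_antisym)
qed

end

section \<open>Linear actions and their weight spaces\<close>

context linear_endo
begin

text \<open>The operators are defined on the whole type; \<open>E\<close> is a projection, and the representation proper
  lives on its range.\<close>

definition linear_action :: "('g, 'c) monoid_scheme \<Rightarrow> ('b \<Rightarrow> 'b) \<Rightarrow> ('g \<Rightarrow> 'b \<Rightarrow> 'b) \<Rightarrow> bool" where
  "linear_action G E r \<longleftrightarrow> (\<forall>g\<in>carrier G. lin (r g)) \<and> (\<forall>v. r \<one>\<^bsub>G\<^esub> v = E v) \<and>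
     (\<forall>g\<in>carrier G. \<forall>h\<in>carrier G. \<forall>v. r (g \<otimes>\<^bsub>G\<^esub> h) v = r g (r h v))"

text \<open>The maps are inverse to each other only up to \<open>E\<close>, since vectors off the
  range of \<open>E\<close> do not belong to the representation.\<close>

definition action_iso :: "('g, 'c) monoid_scheme \<Rightarrow> ('b \<Rightarrow> 'b) \<Rightarrow> ('g \<Rightarrow> 'b \<Rightarrow> 'b) \<Rightarrow>
    ('g \<Rightarrow> 'b \<Rightarrow> 'b) \<Rightarrow> ('b \<Rightarrow> 'b) \<Rightarrow> ('b \<Rightarrow> 'b) \<Rightarrow> bool" where
  "action_iso G E r s T S \<longleftrightarrow> lin T \<and> lin S \<and> (\<forall>v. S (T v) = E v) \<and> (\<forall>v. T (S v) = E v) \<and>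
     (\<forall>g\<in>carrier G. \<forall>v. T (r g v) = s g (T v))"

lemma action_isoD:
  assumes "action_iso G E r s T S"
  shows "lin T" "lin S" "S (T v) = E v" "T (S v) = E v" "g \<in> carrier G \<Longrightarrow> T (r g v) = s g (T v)"
  using assms by (auto simp: action_iso_def)

lemma linear_actionD:
  assumes "linear_action G E r"
  shows "g \<in> carrier G \<Longrightarrow> lin (r g)" "r \<one>\<^bsub>G\<^esub> v = E v"
    "g \<in> carrier G \<Longrightarrow> h \<in> carrier G \<Longrightarrow> r (g \<otimes>\<^bsub>G\<^esub> h) v = r g (r h v)"
  using assms by (auto simp: linear_action_def)

lemma linear_action_simps:
  assumes "linear_action G E r" "g \<in> carrier G"
  shows "r g 0 = 0" "r g (x + y) = r g x + r g y" "r g (scale c x) = scale c (r g x)"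
    "r g (\<Sum>i\<in>I. f i) = (\<Sum>i\<in>I. r g (f i))"
  using linear_actionD(1)[OF assms] by (rule lin_zero lin_add lin_scale lin_sum)+

lemma linear_action_unit:
  assumes "group G" "linear_action G E r" "g \<in> carrier G"
  shows "r g (E v) = r g v" "E (r g v) = r g v"
  using linear_actionD[OF assms(2)] assms(1,3) group.is_monoid monoid.r_one monoid.l_one monoid.one_closed
  by metis+

text \<open>\<open>T\<close> intertwines by definition. For \<open>S\<close> the eigenvector
  equation is transferred by inserting \<open>E\<close>, written as \<open>S\<close> after
  \<open>T\<close> or as \<open>T\<close> after \<open>S\<close>, which the actions absorb.\<close>

lemma action_iso_eigen:
  assumes G: "group G" and r: "linear_action G E r" and s: "linear_action G E s"
    and T: "action_iso G E r s T S" and g: "g \<in> carrier G"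
  shows "r g v = scale c v \<Longrightarrow> s g (T v) = scale c (T v)"
    "s g v = scale c v \<Longrightarrow> r g (S v) = scale c (S v)"
proof -
  note T = action_isoD[OF T]
  show "s g (T v) = scale c (T v)" if "r g v = scale c v"
    using T(5)[OF g, of v] that lin_scale[OF T(1), of c v] by simp
  show "r g (S v) = scale c (S v)" if "s g v = scale c v"
  proof -
    have "r g (S v) = S (T (r g (S v)))"
      using T(3) linear_action_unit[OF G r g] by simp
    also have "\<dots> = S (s g (E v))" using T(4,5) g by simp
    also have "\<dots> = scale c (S v)"
      using that linear_action_unit[OF G s g] lin_scale[OF T(2)] by simp
    finally show ?thesis .
  qed
qed

lemma action_iso_dim_eq:
  assumes "action_iso G E r s T S"
    and W: "subspace W" "\<And>v. v \<in> W \<Longrightarrow> E v = v" "\<And>v. v \<in> W' \<Longrightarrow> E v = v"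
      "\<And>v. v \<in> W \<Longrightarrow> T v \<in> W'" "\<And>v. v \<in> W' \<Longrightarrow> S v \<in> W"
  shows "dim W = dim W'"
  using action_isoD[OF assms(1)]
  by (intro dim_eq_if_inverse[of T W W' S]) (simp_all add: W)

text \<open>Equivariance is tested only for generators and on single blocks. Linearity extends it to
  all vectors, and induction over \<open>generate\<close> to all group elements. An inverse
  generator is handled by applying the known case to \<open>r (inv h) v\<close> and cancelling with
  \<open>s (inv h)\<close>.\<close>

lemma action_isoI:
  fixes G (structure)
  assumes G: "group G" and r: "linear_action G E r" and s: "linear_action G E s"
    and sys: "projection_system E I W P"
    and T: "lin T" "lin S" "\<And>v. S (T v) = E v" "\<And>v. T (S v) = E v" "\<And>v. T (E v) = T v"
    and A: "A \<subseteq> carrier G" "generate G A = carrier G"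
    and tw: "\<And>g i v. g \<in> A \<Longrightarrow> i \<in> I \<Longrightarrow> v \<in> W i \<Longrightarrow> T (r g v) = s g (T v)"
  shows "action_iso G E r s T S"
proof -
  interpret group G by (rule G)
  note Dr = linear_actionD[OF r] and Ds = linear_actionD[OF s]
  note ur = linear_action_unit[OF G r] and us = linear_action_unit[OF G s]
  have TE: "E (T v) = T v" for v using T(3-5) by metis
  have A': "T (r g v) = s g (T v)" if "g \<in> A" for g v
  proof -
    have g: "g \<in> carrier G" using that A by blast
    have "T (r g (E v)) = s g (T (E v))"
    proof (rule projection_system_eqI[OF sys])
      show "lin (\<lambda>v. T (r g v))" by (rule lin_comp[OF T(1) Dr(1)[OF g]])
      show "lin (\<lambda>v. s g (T v))" by (rule lin_comp[OF Ds(1)[OF g] T(1)])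
    qed (rule tw[OF that])
    then show ?thesis using ur[OF g] T(5) by simp
  qed
  have "T (r g v) = s g (T v)" if "g \<in> generate G A" for g v
    using that
  proof (induction arbitrary: v rule: generate.induct)
    case one
    then show ?case using Dr Ds T TE by simp
  next
    case (incl h)
    then show ?case using A' by blast
  next
    case (inv h)
    then have h: "h \<in> carrier G" using A by blast
    have "r h (r (inv h) v) = E v"
      using Dr(3)[of h "inv h" v] h Dr(2) by simp
    then have "s h (T (r (inv h) v)) = T v"
      using A'[OF inv, of "r (inv h) v"] T(5) by simp
    then have "s (inv h) (T v) = s (inv h) (s h (T (r (inv h) v)))" by simp
    also have "\<dots> = E (T (r (inv h) v))"
      using Ds(3)[of "inv h" h "T (r (inv h) v)"] h Ds(2) by simp
    finally show ?case using TE by simp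
  next
    case (eng g h)
    then have "g \<in> carrier G" "h \<in> carrier G" using A generate_in_carrier by blast+
    then show ?case using eng Dr(3) Ds(3) by simp
  qed
  then show ?thesis using T A(2) by (simp add: action_iso_def)
qed

definition weight_space :: "('g, 'c) monoid_scheme \<Rightarrow> ('g \<Rightarrow> 'b \<Rightarrow> 'b) \<Rightarrow> ('g \<Rightarrow> 'a) \<Rightarrow> 'b set" where
  "weight_space G r \<chi> = {v. \<forall>g\<in>carrier G. r g v = scale (\<chi> g) v}"

lemma subspace_weight_space:
  assumes "linear_action G E r"
  shows "subspace (weight_space G r \<chi>)"
  using linear_action_simps[OF assms]
  by (simp add: weight_space_def subspace_def scale_right_distrib mult.commute)

context
  fixes G :: "('g, 'c) monoid_scheme" (structure) and E :: "'b \<Rightarrow> 'b"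
  assumes G: "comm_group G"
    and dual: "dual_orthogonal TYPE('a) G (carrier G)"
    and ord: "of_nat (card (carrier G)) \<noteq> (0::'a)"
begin

interpretation comm_group G by (rule G)

text \<open>This is the action of the central idempotent of the group algebra that belongs to
  \<chi>.\<close>

definition weight_projection :: "('g \<Rightarrow> 'b \<Rightarrow> 'b) \<Rightarrow> ('g \<Rightarrow> 'a) \<Rightarrow> 'b \<Rightarrow> 'b" where
  "weight_projection r \<chi> v =
     scale (inverse (of_nat (card (carrier G)))) (\<Sum>g\<in>carrier G. scale (\<chi> (inv\<^bsub>G\<^esub> g)) (r g v))"

text \<open>Orthogonality, summed over the characters at a fixed group element, leaves only the term
  of \<one> and shows that the projections sum to \<open>E\<close>. Distinct characters differ at
  some \<open>h\<close>, and comparing the two eigenvalues of \<open>h\<close> shows that each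
  projection kills the other weight spaces. On its own weight space it is then the only surviving
  summand of \<open>E\<close>.\<close>

lemma weight_projection_system:
  assumes r: "linear_action G E r"
  shows "projection_system E (characters G (carrier G)) (weight_space G r) (weight_projection r)"
proof -
  let ?C = "characters G (carrier G) :: ('g \<Rightarrow> 'a) set" and ?n = "of_nat (card (carrier G)) :: 'a"
  have fin: "finite (carrier G)" using ord card.infinite by fastforce
  note D = linear_actionD[OF r] and R = linear_action_simps[OF r]
  have lin_P: "lin (weight_projection r \<chi>)" for \<chi>
    unfolding weight_projection_def using D(1) by (intro lin_scale_fun lin_sum_fun) auto
  have P_r: "weight_projection r \<chi> (r h v) = r h (weight_projection r \<chi> v)" if "h \<in> carrier G" for \<chi> h v
  proof -
    have "r g (r h v) = r h (r g v)" if "g \<in> carrier G" for g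
      using D(3)[of g h v] D(3)[of h g v] \<open>h \<in> carrier G\<close> that by (simp add: m_comm)
    then show ?thesis
      using that by (simp add: weight_projection_def R)
  qed
  have P_mem: "weight_projection r \<chi> v \<in> weight_space G r \<chi>" if \<chi>: "\<chi> \<in> ?C" for \<chi> v
    unfolding weight_space_def
  proof (intro CollectI ballI)
    fix h assume h: "h \<in> carrier G"
    have "r h (\<Sum>g\<in>carrier G. scale (\<chi> (inv g)) (r g v)) =
        (\<Sum>g\<in>carrier G. scale (\<chi> (inv g)) (r (h \<otimes> g) v))"
      using D(3) h by (simp add: R)
    \<comment> \<open>Substituting \<open>inv h \<otimes> g\<close> for \<open>g\<close> moves
      \<open>h\<close> from the action into the character, which then releases the factor
      \<open>\<chi> h\<close>.\<close>
    also have "\<dots> = (\<Sum>g\<in>carrier G. scale (\<chi> (inv (inv h \<otimes> g))) (r g v))"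
      by (rule sum.reindex_bij_witness[of _ "\<lambda>g. inv h \<otimes> g" "\<lambda>g. h \<otimes> g"])
        (use h in \<open>simp_all add: m_assoc[symmetric]\<close>)
    also have "\<dots> = (\<Sum>g\<in>carrier G. scale (\<chi> h) (scale (\<chi> (inv g)) (r g v)))"
      by (rule sum.cong) (use h charactersD(3)[OF \<chi>] in \<open>simp_all add: inv_mult_group mult.commute\<close>)
    also have "\<dots> = scale (\<chi> h) (\<Sum>g\<in>carrier G. scale (\<chi> (inv g)) (r g v))"
      by (simp only: scale_sum_right)
    finally show "r h (weight_projection r \<chi> v) = scale (\<chi> h) (weight_projection r \<chi> v)"
      unfolding weight_projection_def R(3)[OF h] by (simp add: mult.commute)
  qed
  have sum_P: "(\<Sum>\<chi>\<in>?C. weight_projection r \<chi> v) = E v" for v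
  proof -
    have "(\<Sum>\<chi>\<in>?C. weight_projection r \<chi> v) =
        scale (inverse ?n) (\<Sum>g\<in>carrier G. \<Sum>\<chi>\<in>?C. scale (\<chi> (inv g)) (r g v))"
      unfolding weight_projection_def by (simp add: sum.swap[of _ ?C] flip: scale_sum_right)
    also have "(\<Sum>g\<in>carrier G. \<Sum>\<chi>\<in>?C. scale (\<chi> (inv g)) (r g v)) =
        (\<Sum>g\<in>carrier G. if g = \<one> then scale ?n (r g v) else 0)"
    proof (rule sum.cong)
      fix g assume g: "g \<in> carrier G"
      have "(\<Sum>\<chi>\<in>?C. \<chi> (inv g)) = (if inv g = \<one> then ?n else 0)"
        using dual g by (simp add: dual_orthogonal_def)
      then show "(\<Sum>\<chi>\<in>?C. scale (\<chi> (inv g)) (r g v)) = (if g = \<one> then scale ?n (r g v) else 0)"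
        using g by (simp add: inv_eq_1_iff flip: scale_sum_left)
    qed simp
    finally show ?thesis using fin ord D(2) by simp
  qed
  have P_zero: "weight_projection r \<chi> v = 0" if *: "\<chi> \<in> ?C" "\<psi> \<in> ?C" "\<chi> \<noteq> \<psi>" "v \<in> weight_space G r \<psi>" for \<chi> \<psi> v
  proof -
    obtain h where h: "h \<in> carrier G" "\<chi> h \<noteq> \<psi> h"
      using *(1-3) charactersD(1) by (metis extensionalityI)
    have "scale (\<chi> h) (weight_projection r \<chi> v) = weight_projection r \<chi> (r h v)"
      using P_r[OF h(1)] P_mem[OF that(1)] h(1) by (simp add: weight_space_def)
    also have "\<dots> = scale (\<psi> h) (weight_projection r \<chi> v)"
      using that(4) h(1) lin_scale[OF lin_P] by (simp add: weight_space_def)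
    finally show ?thesis using h(2) by simp
  qed
  have finC: "finite ?C" using dual by (simp add: dual_orthogonal_def)
  have P_id: "weight_projection r \<chi> v = v" if "\<chi> \<in> ?C" "v \<in> weight_space G r \<chi>" for \<chi> v
  proof -
    have "r \<one> v = scale (\<chi> \<one>) v" using that(2) by (simp add: weight_space_def)
    then have "v = (\<Sum>\<psi>\<in>?C. weight_projection r \<psi> v)"
      using sum_P D(2) charactersD(2)[OF that(1)] by simp
    also have "\<dots> = (\<Sum>\<psi>\<in>?C. if \<psi> = \<chi> then weight_projection r \<chi> v else 0)"
      by (rule sum.cong) (use P_zero that in auto)
    finally show ?thesis using finC that(1) by simp
  qed
  show ?thesis
    unfolding projection_system_def
    using finC subspace_weight_space[OF r] lin_P P_mem P_id P_zero sum_P by blast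
qed

text \<open>Any linear map between weight spaces of the same weight is equivariant, since a group
  element acts on both by the same scalar. So equal dimensions give isomorphisms of the weight
  spaces, and these can be glued; conversely an isomorphism preserves simultaneous
  eigenvectors.\<close>

lemma abelian_action_iso_iff:
  assumes r: "linear_action G E r" and s: "linear_action G E s"
    and F: "finite F" "range E \<subseteq> span F"
  shows "(\<exists>T S. action_iso G E r s T S) \<longleftrightarrow>
    (\<forall>\<chi>\<in>characters G (carrier G). dim (weight_space G r \<chi>) = dim (weight_space G s \<chi>))"
proof
  note sr = weight_projection_system[OF r] and ss = weight_projection_system[OF s]
  note fixr = projection_system_fix[OF sr] and fixs = projection_system_fix[OF ss]
  show "\<forall>\<chi>\<in>characters G (carrier G). dim (weight_space G r \<chi>) = dim (weight_space G s \<chi>)"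
    if "(\<exists>T S. action_iso G E r s T S)"
  proof
    fix \<chi> :: "'g \<Rightarrow> 'a" assume \<chi>: "\<chi> \<in> characters G (carrier G)"
    obtain T S where T: "action_iso G E r s T S"
      using \<open>\<exists>T S. action_iso G E r s T S\<close> by blast
    show "dim (weight_space G r \<chi>) = dim (weight_space G s \<chi>)"
      by (rule action_iso_dim_eq[OF T subspace_weight_space[OF r]])
        (use fixr[OF \<chi>] fixs[OF \<chi>] action_iso_eigen[OF is_group r s T] in \<open>auto simp: weight_space_def\<close>)
  qed
  show "(\<exists>T S. action_iso G E r s T S)"
    if dims: "\<forall>\<chi>\<in>characters G (carrier G). dim (weight_space G r \<chi>) = dim (weight_space G s \<chi>)"
  proof -
    have "\<forall>\<chi>\<in>characters G (carrier G). \<exists>f g. lin f \<and> lin g \<and>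
        (\<forall>x\<in>weight_space G r \<chi>. f x \<in> weight_space G s \<chi> \<and> g (f x) = x) \<and>
        (\<forall>x\<in>weight_space G s \<chi>. g x \<in> weight_space G r \<chi> \<and> f (g x) = x)"
    proof
      fix \<chi> :: "'g \<Rightarrow> 'a" assume \<chi>: "\<chi> \<in> characters G (carrier G)"
      have "weight_space G r \<chi> \<subseteq> span F" "weight_space G s \<chi> \<subseteq> span F"
        using fixr[OF \<chi>] fixs[OF \<chi>] F(2) by (metis rangeI subset_iff)+
      then show "\<exists>f g. lin f \<and> lin g \<and>
        (\<forall>x\<in>weight_space G r \<chi>. f x \<in> weight_space G s \<chi> \<and> g (f x) = x) \<and>
        (\<forall>x\<in>weight_space G s \<chi>. g x \<in> weight_space G r \<chi> \<and> f (g x) = x)"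
        using subspaces_isomorphic[OF subspace_weight_space[OF r, of \<chi>] subspace_weight_space[OF s, of \<chi>]
          dims[rule_format, OF \<chi>] F(1)] by (metis (no_types, lifting))
    qed
    then obtain f g where fg: "\<And>\<chi>. \<chi> \<in> characters G (carrier G) \<Longrightarrow> lin (f \<chi>) \<and> lin (g \<chi>) \<and>
        (\<forall>x\<in>weight_space G r \<chi>. f \<chi> x \<in> weight_space G s \<chi> \<and> g \<chi> (f \<chi> x) = x) \<and>
        (\<forall>x\<in>weight_space G s \<chi>. g \<chi> x \<in> weight_space G r \<chi> \<and> f \<chi> (g \<chi> x) = x)"
      by metis
    obtain T S where T: "lin T" "lin S" "\<And>v. S (T v) = E v" "\<And>v. T (S v) = E v"
      "\<And>\<chi> v. \<chi> \<in> characters G (carrier G) \<Longrightarrow> v \<in> weight_space G r \<chi> \<Longrightarrow> T v = f \<chi> v"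
      "\<And>v. T (E v) = T v" "\<And>v. E (T v) = T v"
      by (rule projection_system_glue[OF sr ss, of f g]) (simp_all add: fg)
    have "action_iso G E r s T S"
    proof (rule action_isoI[OF is_group r s sr T(1-4,6), of "carrier G"])
      show "generate G (carrier G) = carrier G"
        by (rule subset_antisym) (auto simp: generate_incl intro: generate.incl)
    next
      fix h \<chi> v assume *: "h \<in> carrier G" "\<chi> \<in> characters G (carrier G)" "v \<in> weight_space G r \<chi>"
      then have "T v \<in> weight_space G s \<chi>" using T(5) fg by simp
      then show "T (r h v) = s h (T v)"
        using * lin_scale[OF T(1)] by (simp add: weight_space_def)
    qed simp
    then show ?thesis by blast
  qed
qed

end

end

section \<open>Actions of the nonabelian groups of order 8\<close>

text \<open>The second relation says that conjugation by \<open>b\<close> inverts \<open>a\<close>.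
  The last alternative separates the dihedral from the quaternion case. Products are nested to the
  right so that they translate directly into iterated operators.\<close>

locale nonabelian_generators = group G for G (structure) +
  fixes a b
  assumes gens: "a \<in> carrier G" "b \<in> carrier G" "generate G {a, b} = carrier G"
    and rels: "a \<otimes> (a \<otimes> (a \<otimes> a)) = \<one>" "b \<otimes> a = a \<otimes> (a \<otimes> (a \<otimes> b))"
      "b \<otimes> b = \<one> \<or> b \<otimes> b = a \<otimes> a"

text \<open>The first component is the eigenvalue of \<open>a\<close>, the second one that of \<open>b\<close>, where \<open>0\<close> stands for
  no condition on \<open>b\<close>.\<close>

definition block_index :: "'k::field \<Rightarrow> ('k \<times> 'k) set" where
  "block_index \<iota> = {(1, 1), (1, -1), (-1, 1), (-1, -1), (\<iota>, 0), (-\<iota>, 0)}"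

lemma block_index_facts:
  fixes \<iota> :: "'k::field"
  assumes iota: "\<iota> * \<iota> = -1" and two: "(2::'k) \<noteq> 0"
  shows
  "(1::'k) \<noteq> -1" "\<iota> \<noteq> 1" "\<iota> \<noteq> -1" "-\<iota> \<noteq> \<iota>" "-\<iota> \<noteq> 1" "-\<iota> \<noteq> -1" "\<iota> \<noteq> 0"
proof -
  show 1: "(1::'k) \<noteq> -1" using two by (metis add.right_inverse one_add_one)
  show "\<iota> \<noteq> 1" "\<iota> \<noteq> -1" "\<iota> \<noteq> 0" using iota 1 by auto
  then show "-\<iota> \<noteq> 1" "-\<iota> \<noteq> -1" by (metis minus_minus)+
  show "-\<iota> \<noteq> \<iota>" using two \<open>\<iota> \<noteq> 0\<close>
    by (metis add.right_inverse mult_2 mult_eq_0_iff)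
qed

section \<open>Projections onto the joint eigenspaces of \<open>a\<close> and
  \<open>b\<close>\<close>

context linear_endo
begin

definition block_space :: "'g \<Rightarrow> 'g \<Rightarrow> ('g \<Rightarrow> 'b \<Rightarrow> 'b) \<Rightarrow> 'a \<times> 'a \<Rightarrow> 'b set" where
  "block_space a b r p =
     {v. r a v = scale (fst p) v \<and> (snd p \<noteq> 0 \<longrightarrow> r b v = scale (snd p) v)}"

text \<open>The average of \<open>A\<close> over a cyclic group of order 4, twisted by inverse
  powers of \<open>c\<close>: if \<open>c ^ 4 = 1\<close>, the inverses of \<open>c\<close>,
  \<open>c^2\<close>, \<open>c^3\<close> are \<open>c^3\<close>, \<open>c^2\<close>,
  \<open>c\<close>. The zeroth power of \<open>A\<close> is \<open>E\<close>.\<close>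

definition eigen_projection :: "('b \<Rightarrow> 'b) \<Rightarrow> ('b \<Rightarrow> 'b) \<Rightarrow> 'a \<Rightarrow> 'b \<Rightarrow> 'b" where
  "eigen_projection E A c v = scale (1/4) (E v) + scale (1/4 * c^3) (A v)
     + scale (1/4 * c^2) (A (A v)) + scale (1/4 * c) (A (A (A v)))"

text \<open>After the projection for \<open>a\<close>, the average over \<open>b\<close>, which
  squares to the identity on the eigenspaces where this second step is taken; the eigenvalue 1 or -1
  of \<open>b\<close> is its own inverse.\<close>

definition block_projection :: "'g \<Rightarrow> 'g \<Rightarrow> ('b \<Rightarrow> 'b) \<Rightarrow> ('g \<Rightarrow> 'b \<Rightarrow> 'b) \<Rightarrow> 'a \<times> 'a \<Rightarrow> 'b \<Rightarrow> 'b" where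
  "block_projection a b E r p v =
     (let w = eigen_projection E (r a) (fst p) v
      in if snd p = 0 then w else scale (1/2) w + scale (1/2 * snd p) (r b w))"

context
  fixes E and A :: "'b \<Rightarrow> 'b"
  assumes A: "lin A" "lin E" "\<And>v. A (A (A (A v))) = E v" "\<And>v. A (E v) = A v" "\<And>v. E (A v) = A v"
    and two: "(2::'a) \<noteq> 0"
begin

lemma lin_eigen_projection: "lin (eigen_projection E A c)"
proof -
  have A2: "lin (\<lambda>v. A (A v))" by (rule lin_comp[OF A(1) A(1)])
  then have "lin (\<lambda>v. A (A (A v)))" by (rule lin_comp[OF A(1)])
  then show ?thesis
    unfolding eigen_projection_def by (intro lin_add_fun lin_scale_fun A(1,2) A2)
qed

lemma eigen_projection_comm: "eigen_projection E A c (A v) = A (eigen_projection E A c v)"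
  by (simp only: eigen_projection_def lin_add[OF A(1)] lin_scale[OF A(1)] A(3-5))

lemma eigen_projection_eigen:
  assumes "c ^ 4 = 1"
  shows "A (eigen_projection E A c v) = scale c (eigen_projection E A c v)"
proof -
  define q where "q = (1/4 :: 'a)"
  have "c * (q * c ^ 3) = q * c ^ 4" by (simp add: power3_eq_cube power4_eq_xxxx mult_ac)
  then have "c * (q * c ^ 3) = q" using assms by simp
  moreover have "c * (q * c ^ 2) = q * c ^ 3" "c * (q * c) = q * c ^ 2" "c * q = q * c"
    by (simp_all add: power2_eq_square power3_eq_cube mult_ac)
  ultimately show ?thesis
    unfolding eigen_projection_def q_def[symmetric]
    by (simp only: lin_add[OF A(1)] lin_scale[OF A(1)] A scale_right_distrib scale_scale add_ac)
qed

text \<open>The projection commutes with \<open>A\<close>, so the projected vector is an eigenvector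
  for \<open>c\<close> and for \<open>d\<close> at once.\<close>

lemma eigen_projection_zero:
  assumes "c ^ 4 = 1" "A v = scale d v" "c \<noteq> d"
  shows "eigen_projection E A c v = 0"
proof -
  have "scale c (eigen_projection E A c v) = scale d (eigen_projection E A c v)"
    using eigen_projection_comm[of c v] eigen_projection_eigen[OF assms(1), of v]
    by (simp only: assms(2) lin_scale[OF lin_eigen_projection])
  then show ?thesis using assms(3) by simp
qed

text \<open>The four values of \<open>c\<close> are the fourth roots of unity. Their odd powers
  cancel in pairs, their squares are 1, 1, -1, -1, and only the coefficient of \<open>E\<close>
  survives, being four times 1/4.\<close>

lemma eigen_projection_sum:
  assumes "\<iota> * \<iota> = -1"
  shows "eigen_projection E A 1 v + eigen_projection E A (-1) v +
    (eigen_projection E A \<iota> v + eigen_projection E A (-\<iota>) v) = E v"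
proof -
  define q where "q = (1/4 :: 'a)"
  have comb: "(scale a1 x + scale b1 y + scale c1 z + scale d1 w) + (scale a2 x + scale b2 y + scale c2 z + scale d2 w)
    = scale (a1 + a2) x + scale (b1 + b2) y + scale (c1 + c2) z + scale (d1 + d2) w"
    for a1 a2 b1 b2 c1 c2 d1 d2 x y z w by (simp add: scale_left_distrib add_ac)
  have "(4::'a) = 2 * 2" by simp
  then have four: "(4::'a) \<noteq> 0" using two by (metis mult_eq_0_iff)
  have "q + q + (q + q) = 4 * q" by (simp add: algebra_simps)
  then have q1: "q + q + (q + q) = 1" using four by (simp add: q_def)
  have q2: "q * 1 ^ 3 + q * (-1) ^ 3 + (q * \<iota> ^ 3 + q * (-\<iota>) ^ 3) = 0"
    by (simp add: power3_eq_cube)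
  have q3: "q * 1\<^sup>2 + q * (-1)\<^sup>2 + (q * \<iota>\<^sup>2 + q * (-\<iota>)\<^sup>2) = 0"
    using assms by (simp add: power2_eq_square)
  have q4: "q * 1 + q * (-1) + (q * \<iota> + q * (-\<iota>)) = 0" by simp
  show ?thesis
    unfolding eigen_projection_def q_def[symmetric] comb q1 q2 q3 q4 by simp
qed

end

end

context nonabelian_generators
begin

context
  fixes scale :: "'k::field \<Rightarrow> 'v::ab_group_add \<Rightarrow> 'v" and E r and \<iota> :: 'k
  assumes V: "linear_endo scale" and r: "linear_endo.linear_action scale G E r"
    and iota: "\<iota> * \<iota> = -1" and two: "(2::'k) \<noteq> 0"
begin

interpretation linear_endo scale by (rule V)

lemma block_action_rels:
  "lin E" "lin (r a)" "lin (r b)"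
  "r a (r a (r a (r a v))) = E v" "r a (E v) = r a v" "E (r a v) = r a v"
  "r b (r a v) = r a (r a (r a (r b v)))" "r b (E v) = r b v" "E (r b v) = r b v"
  "(r b (r b v) = (if b \<otimes> b = \<one> then E v else r a (r a v)))"
proof -
  note D = linear_actionD[OF r] and u = linear_action_unit[OF is_group r]
  have "r \<one> = E" using D(2) by blast
  then show "lin E" using D(1) by force
  show "lin (r a)" "lin (r b)" "r a (E v) = r a v" "E (r a v) = r a v" "r b (E v) = r b v" "E (r b v) = r b v"
    using D u gens by simp_all
  show "r a (r a (r a (r a v))) = E v"
    using D(3)[of a "a \<otimes> (a \<otimes> a)" v] D(3)[of a "a \<otimes> a" v] D(3)[of a a v] D(2)[of v] gens rels(1) by simp
  show "r b (r a v) = r a (r a (r a (r b v)))"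
    using D(3)[of a "a \<otimes> (a \<otimes> b)" v] D(3)[of a "a \<otimes> b" v] D(3)[of a b v] D(3)[of b a v] gens rels(2) by simp
  show "(r b (r b v) = (if b \<otimes> b = \<one> then E v else r a (r a v)))"
    using D(3)[of b b v] D(3)[of a a v] D(2)[of v] gens rels(3) by auto
qed

lemma block_index_power: "p \<in> block_index \<iota> \<Longrightarrow> fst p ^ 4 = 1"
  using iota by (auto simp: block_index_def power4_eq_xxxx)

lemma block_index_real: "p \<in> block_index \<iota> \<Longrightarrow> snd p \<noteq> 0 \<Longrightarrow> (fst p = 1 \<or> fst p = -1) \<and> (snd p = 1 \<or> snd p = -1)"
  by (auto simp: block_index_def)

lemma subspace_block_space: "subspace (block_space a b r p)"
proof -
  have "subspace ({v. r a v = scale (fst p) v} \<inter> (if snd p = 0 then UNIV else {v. r b v = scale (snd p) v}))"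
    by (intro subspace_inter subspace_eigen block_action_rels) (simp add: subspace_eigen block_action_rels)
  moreover have "block_space a b r p = {v. r a v = scale (fst p) v} \<inter> (if snd p = 0 then UNIV else {v. r b v = scale (snd p) v})"
    by (auto simp: block_space_def)
  ultimately show ?thesis by simp
qed

text \<open>Moving \<open>b\<close> to the left past the third power of \<open>a\<close> produces
  the ninth power, which is \<open>a\<close> again. Cubing fixes the eigenvalues 1 and -1 and
  exchanges \<iota> and -\<iota>.\<close>

lemma b_swaps_eigenspaces:
  assumes "r a v = scale c v"
  shows "r a (r b v) = scale (c ^ 3) (r b v)"
proof -
  have "r a (r b v) = r b (r a (r a (r a v)))"
    using block_action_rels(4-7) by metis
  then show ?thesis
    using assms by (simp add: lin_scale[OF block_action_rels(2)] lin_scale[OF block_action_rels(3)] power3_eq_cube)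
qed

text \<open>On these eigenspaces the square of \<open>a\<close> is the identity, so both
  alternatives for the square of \<open>b\<close> give the same operator; this is why both groups
  have the same four types of degree 1.\<close>

lemma b_square_real:
  assumes "r a v = scale c v" "c = 1 \<or> c = -1"
  shows "r b (r b v) = v"
proof -
  have "r a (r a v) = v" using assms by (auto simp: lin_scale[OF block_action_rels(2)])
  then show ?thesis using block_action_rels(4)[of v] block_action_rels(10)[of v] by simp
qed

text \<open>The eigenspaces of \<open>a\<close> for 1 and -1 are stable under \<open>b\<close>,
  which is an involution there, and are halved by its eigenvalue. Those for \<iota> and -\<iota>
  stay whole because \<open>b\<close> exchanges them.\<close>

lemma block_projection_system:
  "projection_system E (block_index \<iota>) (block_space a b r) (block_projection a b E r)"
proof -
  note R = block_action_rels
  let ?Q = "eigen_projection E (r a)"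
  note linQ = lin_eigen_projection[OF R(2,1,4-6) two]
    and Qeig = eigen_projection_eigen[OF R(2,1,4-6) two]
    and Qzero = eigen_projection_zero[OF R(2,1,4-6) two]
    and Qsum = eigen_projection_sum[OF R(2,1,4-6) two iota]
  have half: "scale (1/2) w + scale (1/2) w = w" for w
    using two by (simp flip: scale_left_distrib)
  have lin: "lin (block_projection a b E r p)" for p
  proof (cases "snd p = 0")
    case True
    then have "block_projection a b E r p = ?Q (fst p)" by (simp add: fun_eq_iff block_projection_def)
    then show ?thesis using linQ by simp
  next
    case False
    then have "block_projection a b E r p = (\<lambda>v. scale (1/2) (?Q (fst p) v) + scale (1/2 * snd p) (r b (?Q (fst p) v)))"
      by (simp add: fun_eq_iff block_projection_def Let_def)
    then show ?thesis using linQ R by (simp add: lin_add_fun lin_scale_fun lin_comp[of "r b"])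
  qed
  have mem: "block_projection a b E r p v \<in> block_space a b r p" if p: "p \<in> block_index \<iota>" for p v
  proof (cases "snd p = 0")
    case True
    then show ?thesis using Qeig[OF block_index_power[OF p]] by (simp add: block_projection_def block_space_def)
  next
    case False
    define w where "w = ?Q (fst p) v"
    have w: "r a w = scale (fst p) w" using Qeig[OF block_index_power[OF p]] by (simp add: w_def)
    note real = block_index_real[OF p False]
    have aw: "r a (r b w) = scale (fst p) (r b w)" using b_swaps_eigenspaces[OF w] real by auto
    have bw: "r b (r b w) = w" using b_square_real[OF w] real by simp
    have P: "block_projection a b E r p v = scale (1/2) w + scale (1/2 * snd p) (r b w)"
      using False by (simp add: block_projection_def Let_def w_def)
    show ?thesis
      unfolding block_space_def P
      using real
      by (auto simp: lin_add[OF R(2)] lin_add[OF R(3)] lin_scale[OF R(2)] lin_scale[OF R(3)] w aw bw scale_right_distrib add_ac)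
  qed
  have eigE: "E v = v" if "r a v = scale c v" "c ^ 4 = 1" for v c
    using R(4)[of v] that by (simp add: lin_scale[OF R(2)] power4_eq_xxxx)
  \<comment> \<open>Three of the four eigenprojections vanish on an eigenvector and all four sum to
    \<open>E\<close>, so the remaining one fixes it.\<close>
  have Qfix: "?Q (fst p) v = v" if p: "p \<in> block_index \<iota>" and v: "r a v = scale (fst p) v" for p v
  proof -
    have z: "?Q c v = 0" if "c \<in> {1, -1, \<iota>, -\<iota>}" "c \<noteq> fst p" for c
      using Qzero[OF _ v that(2)] that(1) block_index_power[of "(c, _)"] iota by (auto simp: power4_eq_xxxx)
    have "fst p \<in> {1, -1, \<iota>, -\<iota>}" using p by (auto simp: block_index_def)
    moreover have "?Q 1 v + ?Q (-1) v + (?Q \<iota> v + ?Q (-\<iota>) v) = v"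
      using Qsum eigE[OF v block_index_power[OF p]] by simp
    ultimately show ?thesis
      using z[of 1] z[of "-1"] z[of \<iota>] z[of "-\<iota>"] block_index_facts[OF iota two]
      by (simp only: insert_iff empty_iff) (elim disjE; simp)
  qed
  have zero: "block_projection a b E r p v = 0"
    if p: "p \<in> block_index \<iota>" and q: "q \<in> block_index \<iota>" and "p \<noteq> q" and v: "v \<in> block_space a b r q" for p q v
  proof (cases "fst p = fst q")
    case False
    then have "?Q (fst p) v = 0" using Qzero[OF block_index_power[OF p], of v "fst q"] v by (simp add: block_space_def)
    then show ?thesis by (simp add: block_projection_def lin_zero[OF R(3)])
  next
    case True
    then have s: "snd p \<noteq> snd q" using \<open>p \<noteq> q\<close> by (simp add: prod_eq_iff)
    \<comment> \<open>Different blocks share the eigenvalue of \<open>a\<close> only when it is 1 or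
      -1; their eigenvalues of \<open>b\<close> are then opposite, and the two halves of the
      projection cancel.\<close>
    then have s0: "snd p \<noteq> 0" "snd q \<noteq> 0" and sq: "snd p * snd q = -1"
      using p q True block_index_facts[OF iota two] by (auto simp: block_index_def)
    have "?Q (fst p) v = v" using Qfix[OF p] v True by (simp add: block_space_def)
    then show ?thesis
      using s0 sq v by (simp add: block_projection_def block_space_def mult.assoc scale_minus_left)
  qed
  have fix': "block_projection a b E r p v = v" if p: "p \<in> block_index \<iota>" and v: "v \<in> block_space a b r p" for p v
  proof (cases "snd p = 0")
    case True
    then show ?thesis using Qfix[OF p] v by (simp add: block_projection_def block_space_def)
  next
    case False
    then have "snd p * snd p = 1" using block_index_real[OF p] by auto
    then show ?thesis
      using False Qfix[OF p] v half[of v] by (simp add: block_projection_def block_space_def mult.assoc)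
  qed
  have split: "scale (1/2) w + scale (1/2) x + (scale (1/2) w + scale (1/2 * -1) x) = w" for w x
    using half[of w] by (simp add: algebra_simps)
  have sum: "(\<Sum>p\<in>block_index \<iota>. block_projection a b E r p v) = E v" for v
  proof -
    have "(\<Sum>p\<in>block_index \<iota>. block_projection a b E r p v) = ?Q 1 v + ?Q (-1) v + (?Q \<iota> v + ?Q (-\<iota>) v)"
      using block_index_facts[OF iota two] split[of "?Q 1 v" "r b (?Q 1 v)"] split[of "?Q (-1) v" "r b (?Q (-1) v)"]
      by (simp add: block_index_def block_projection_def Let_def add_ac)
    then show ?thesis using Qsum by simp
  qed
  show ?thesis
    unfolding projection_system_def
    using subspace_block_space lin mem fix' zero sum by (auto simp: block_index_def)
qed

text \<open>This makes the third power of \<open>b\<close> an inverse of \<open>b\<close> in the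
  dihedral and the quaternion case alike.\<close>

lemma b_power_4: "r b (r b (r b (r b v))) = E v"
proof (cases "b \<otimes> b = \<one>")
  case True
  then show ?thesis using block_action_rels(8-10) by simp
next
  case False
  then have "r b (r b w) = r a (r a w)" for w using block_action_rels(10)[of w] by simp
  then show ?thesis using block_action_rels(4)[of v] by simp
qed

lemma b_swaps_blocks:
  assumes "c = \<iota> \<or> c = -\<iota>" "v \<in> block_space a b r (c, 0)"
  shows "r b v \<in> block_space a b r (-c, 0)"
proof -
  have "c ^ 3 = -c" using assms(1) iota by (auto simp: power3_eq_cube)
  then show ?thesis using assms(2) b_swaps_eigenspaces[of v c] by (simp add: block_space_def)
qed

lemma dim_swapped_blocks: "dim (block_space a b r (-\<iota>, 0)) = dim (block_space a b r (\<iota>, 0))"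
proof (rule sym, rule dim_eq_if_inverse[where f = "r b" and g = "\<lambda>v. r b (r b (r b v))"])
  note fixE = projection_system_fix[OF block_projection_system]
  have idx: "(\<iota>, 0) \<in> block_index \<iota>" "(-\<iota>, 0) \<in> block_index \<iota>" by (simp_all add: block_index_def)
  show "r b (r b (r b (r b v))) = v" if "v \<in> block_space a b r (\<iota>, 0)" for v
    using b_power_4 fixE[OF idx(1) that] by simp
  show "r b (r b (r b (r b v))) = v" if "v \<in> block_space a b r (-\<iota>, 0)" for v
    using b_power_4 fixE[OF idx(2) that] by simp
  show "r b v \<in> block_space a b r (-\<iota>, 0)" if "v \<in> block_space a b r (\<iota>, 0)" for v
    using b_swaps_blocks[OF _ that] by simp
  show "r b (r b (r b v)) \<in> block_space a b r (\<iota>, 0)" if "v \<in> block_space a b r (-\<iota>, 0)" for v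
    using b_swaps_blocks[of "-\<iota>" v] b_swaps_blocks[of \<iota> "r b v"] b_swaps_blocks[of "-\<iota>" "r b (r b v)"] that by simp
qed (simp_all add: block_action_rels subspace_block_space)

lemma dim_range_blocks:
  assumes "finite F" "range E \<subseteq> span F"
  shows "dim (range E) = dim (block_space a b r (1, 1)) + dim (block_space a b r (1, -1))
    + dim (block_space a b r (-1, 1)) + dim (block_space a b r (-1, -1))
    + 2 * dim (block_space a b r (\<iota>, 0))"
  using dim_projection_system[OF block_projection_system assms] block_index_facts[OF iota two]
  by (simp add: block_index_def dim_swapped_blocks)

end

text \<open>Between blocks of equal index every linear map intertwines \<open>a\<close>, and also
  \<open>b\<close> where an eigenvalue of \<open>b\<close> is prescribed. Only the two blocks
  exchanged by \<open>b\<close> need coordination: the map on the block of \<iota> determines the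
  one on the block of -\<iota>, which is why the latter has no condition of its own.\<close>

lemma nonabelian_action_iso_iff:
  fixes scale :: "'k::field \<Rightarrow> 'v::ab_group_add \<Rightarrow> 'v"
  assumes V: "linear_endo scale" and r: "linear_endo.linear_action scale G E r"
    and s: "linear_endo.linear_action scale G E s"
    and iota: "\<iota> * \<iota> = -1" and two: "(2::'k) \<noteq> 0"
    and F: "finite F" "range E \<subseteq> module.span scale F"
  shows "(\<exists>T S. linear_endo.action_iso scale G E r s T S) \<longleftrightarrow>
    (\<forall>p\<in>{(1, 1), (1, -1), (-1, 1), (-1, -1), (\<iota>, 0)}.
      vector_space.dim scale (linear_endo.block_space scale a b r p) =
      vector_space.dim scale (linear_endo.block_space scale a b s p))"
proof -
  interpret linear_endo scale by (rule V)
  note sr = block_projection_system[OF V r iota two] and ss = block_projection_system[OF V s iota two]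
  note fixr = projection_system_fix[OF sr] and fixs = projection_system_fix[OF ss]
  note Rr = block_action_rels[OF V r iota two] and Rs = block_action_rels[OF V s iota two]
  note subr = subspace_block_space[OF V r iota two] and subs = subspace_block_space[OF V s iota two]
  let ?J = "{(1, 1), (1, -1), (-1, 1), (-1, -1), (\<iota>, 0)} :: ('k \<times> 'k) set"
  have J: "p \<in> block_index \<iota>" if "p \<in> ?J" for p
    using that by (auto simp: block_index_def)
  show ?thesis
  proof
    assume "\<exists>T S. action_iso G E r s T S"
    then obtain T S where T: "action_iso G E r s T S" by blast
    show "\<forall>p\<in>?J. dim (block_space a b r p) = dim (block_space a b s p)"
    proof
      fix p assume "p \<in> ?J"
      note p = J[OF this]
      show "dim (block_space a b r p) = dim (block_space a b s p)"
        by (rule action_iso_dim_eq[OF T subr])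
          (use fixr[OF p] fixs[OF p] action_iso_eigen[OF is_group r s T] gens in \<open>auto simp: block_space_def\<close>)
    qed
  next
    assume dims: "\<forall>p\<in>?J. dim (block_space a b r p) = dim (block_space a b s p)"
    have "\<forall>p\<in>?J. \<exists>f g. lin f \<and> lin g \<and>
        (\<forall>x\<in>block_space a b r p. f x \<in> block_space a b s p \<and> g (f x) = x) \<and>
        (\<forall>x\<in>block_space a b s p. g x \<in> block_space a b r p \<and> f (g x) = x)"
    proof
      fix p assume pJ: "p \<in> ?J"
      have "block_space a b r p \<subseteq> span F" "block_space a b s p \<subseteq> span F"
        using fixr[OF J[OF pJ]] fixs[OF J[OF pJ]] F(2) by (metis rangeI subset_iff)+
      then show "\<exists>f g. lin f \<and> lin g \<and>
        (\<forall>x\<in>block_space a b r p. f x \<in> block_space a b s p \<and> g (f x) = x) \<and>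
        (\<forall>x\<in>block_space a b s p. g x \<in> block_space a b r p \<and> f (g x) = x)"
        using subspaces_isomorphic[OF subr[of p] subs[of p] dims[rule_format, OF pJ] F(1)]
        by (metis (no_types, lifting))
    qed
    then obtain f g where fg: "\<And>p. p \<in> ?J \<Longrightarrow> lin (f p) \<and> lin (g p) \<and>
        (\<forall>x\<in>block_space a b r p. f p x \<in> block_space a b s p \<and> g p (f p x) = x) \<and>
        (\<forall>x\<in>block_space a b s p. g p x \<in> block_space a b r p \<and> f p (g p x) = x)"
      by metis
    \<comment> \<open>On the \<open>-\<iota>\<close> eigenspace of \<open>a\<close>, which is the image under \<open>b\<close> of the \<open>\<iota>\<close> eigenspace, the
      isomorphism is forced by equivariance under \<open>b\<close>.\<close>
    define t where "t p = (if p = (-\<iota>, 0) then \<lambda>v. s b (f (\<iota>, 0) (r b (r b (r b v)))) else f p)" for p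
    define u where "u p = (if p = (-\<iota>, 0) then \<lambda>v. r b (g (\<iota>, 0) (s b (s b (s b v)))) else g p)" for p
    have iJ: "(\<iota>, 0) \<in> ?J" by simp
    have iB: "(\<iota>, 0) \<in> block_index \<iota>" "(-\<iota>, 0) \<in> block_index \<iota>" by (simp_all add: block_index_def)
    have b3: "r b (r b (r b v)) \<in> block_space a b r (\<iota>, 0)" if "v \<in> block_space a b r (-\<iota>, 0)" for v
      using b_swaps_blocks[OF V r iota two, of "-\<iota>" v] b_swaps_blocks[OF V r iota two, of \<iota> "r b v"]
        b_swaps_blocks[OF V r iota two, of "-\<iota>" "r b (r b v)"] that by simp
    have b3': "s b (s b (s b v)) \<in> block_space a b s (\<iota>, 0)" if "v \<in> block_space a b s (-\<iota>, 0)" for v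
      using b_swaps_blocks[OF V s iota two, of "-\<iota>" v] b_swaps_blocks[OF V s iota two, of \<iota> "s b v"]
        b_swaps_blocks[OF V s iota two, of "-\<iota>" "s b (s b v)"] that by simp
    have cases: "p = (-\<iota>, 0) \<or> p \<in> ?J \<and> t p = f p \<and> u p = g p" if "p \<in> block_index \<iota>" for p
      using that block_index_facts[OF iota two] unfolding t_def u_def block_index_def by auto
    have t5: "t (-\<iota>, 0) = (\<lambda>v. s b (f (\<iota>, 0) (r b (r b (r b v)))))"
      and u5: "u (-\<iota>, 0) = (\<lambda>v. r b (g (\<iota>, 0) (s b (s b (s b v)))))"
      by (simp_all add: t_def u_def)
    have lin_t: "lin (t p)" "lin (u p)" if "p \<in> block_index \<iota>" for p
    proof -
      have 1: "lin (\<lambda>v. r b (r b (r b v)))" "lin (\<lambda>v. s b (s b (s b v)))"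
        using lin_comp[OF Rr(3) lin_comp[OF Rr(3) Rr(3)]] lin_comp[OF Rs(3) lin_comp[OF Rs(3) Rs(3)]] by simp_all
      have "lin (\<lambda>v. s b (f (\<iota>, 0) (r b (r b (r b v)))))"
        by (rule lin_comp[OF Rs(3)], rule lin_comp[OF _ 1(1)]) (use fg[OF iJ] in blast)
      moreover have "lin (\<lambda>v. r b (g (\<iota>, 0) (s b (s b (s b v)))))"
        by (rule lin_comp[OF Rr(3)], rule lin_comp[OF _ 1(2)]) (use fg[OF iJ] in blast)
      ultimately show "lin (t p)" "lin (u p)" using cases[OF that] fg t5 u5 by metis+
    qed
    have t_mem: "t p v \<in> block_space a b s p" if "p \<in> block_index \<iota>" "v \<in> block_space a b r p" for p v
      using cases[OF that(1)]
    proof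
      assume p: "p = (-\<iota>, 0)"
      then have "f (\<iota>, 0) (r b (r b (r b v))) \<in> block_space a b s (\<iota>, 0)" using fg[OF iJ] b3 that by blast
      then show ?thesis using b_swaps_blocks[OF V s iota two, of \<iota>] p t5 by simp
    qed (use fg that in auto)
    have u_mem: "u p v \<in> block_space a b r p" if "p \<in> block_index \<iota>" "v \<in> block_space a b s p" for p v
      using cases[OF that(1)]
    proof
      assume p: "p = (-\<iota>, 0)"
      then have "g (\<iota>, 0) (s b (s b (s b v))) \<in> block_space a b r (\<iota>, 0)" using fg[OF iJ] b3' that by blast
      then show ?thesis using b_swaps_blocks[OF V r iota two, of \<iota>] p u5 by simp
    qed (use fg that in auto)
    have ut: "u p (t p v) = v" if "p \<in> block_index \<iota>" "v \<in> block_space a b r p" for p v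
      using cases[OF that(1)]
    proof
      assume p: "p = (-\<iota>, 0)"
      let ?w = "r b (r b (r b v))"
      have w: "?w \<in> block_space a b r (\<iota>, 0)" using b3 that p by blast
      have "s b (s b (s b (s b (f (\<iota>, 0) ?w)))) = f (\<iota>, 0) ?w"
        using b_power_4[OF V s iota two] fixs[OF iB(1)] fg[OF iJ] w by simp
      then have "u p (t p v) = r b ?w" using fg[OF iJ] w p t5 u5 by simp
      then show ?thesis using b_power_4[OF V r iota two] fixr that by simp
    qed (use fg that in auto)
    have tu: "t p (u p v) = v" if "p \<in> block_index \<iota>" "v \<in> block_space a b s p" for p v
      using cases[OF that(1)]
    proof
      assume p: "p = (-\<iota>, 0)"
      let ?w = "s b (s b (s b v))"
      have w: "?w \<in> block_space a b s (\<iota>, 0)" using b3' that p by blast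
      have "r b (r b (r b (r b (g (\<iota>, 0) ?w)))) = g (\<iota>, 0) ?w"
        using b_power_4[OF V r iota two] fixr[OF iB(1)] fg[OF iJ] w by simp
      then have "t p (u p v) = s b ?w" using fg[OF iJ] w p t5 u5 by simp
      then show ?thesis using b_power_4[OF V s iota two] fixs that by simp
    qed (use fg that in auto)
    obtain T S where T: "lin T" "lin S" "\<And>v. S (T v) = E v" "\<And>v. T (S v) = E v"
      "\<And>p v. p \<in> block_index \<iota> \<Longrightarrow> v \<in> block_space a b r p \<Longrightarrow> T v = t p v"
      "\<And>v. T (E v) = T v" "\<And>v. E (T v) = T v"
      by (rule projection_system_glue[OF sr ss, of t u]) (simp_all add: lin_t t_mem u_mem ut tu)
    have Ta: "T (r a v) = s a (T v)" if "p \<in> block_index \<iota>" "v \<in> block_space a b r p" for p v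
      using that t_mem[OF that] lin_scale[OF T(1)] by (simp add: T(5)[OF that] block_space_def)
    have Tb: "T (r b v) = s b (T v)" if "p \<in> block_index \<iota>" "v \<in> block_space a b r p" for p v
    proof -
      have "snd p \<noteq> 0 \<or> p = (\<iota>, 0) \<or> p = (-\<iota>, 0)"
        using that(1) by (auto simp: block_index_def)
      then consider "snd p \<noteq> 0" | "p = (\<iota>, 0)" | "p = (-\<iota>, 0)"
        by blast
      then show ?thesis
      proof cases
        case 1
        then show ?thesis
          using that t_mem[OF that] lin_scale[OF T(1)] by (simp add: T(5)[OF that] block_space_def)
      next
        case 2
        then have "r b v \<in> block_space a b r (-\<iota>, 0)" using b_swaps_blocks[OF V r iota two, of \<iota>] that by simp
        then have "T (r b v) = s b (f (\<iota>, 0) (r b (r b (r b (r b v)))))" using T(5)[OF iB(2)] t5 by simp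
        also have "\<dots> = s b (f (\<iota>, 0) v)" using b_power_4[OF V r iota two] fixr[OF that] by simp
        finally show ?thesis using T(5)[OF that] 2 block_index_facts[OF iota two] by (simp add: t_def)
      next
        case 3
        define w where "w = r b v"
        have w: "w \<in> block_space a b r (\<iota>, 0)" using b_swaps_blocks[OF V r iota two, of "-\<iota>"] that 3 by (simp add: w_def)
        then have fw: "f (\<iota>, 0) w \<in> block_space a b s (\<iota>, 0)" using fg[OF iJ] by blast
        \<comment> \<open>On the \<iota> eigenspace of \<open>a\<close> the square of
          \<open>b\<close> is 1 or the square of \<iota>, which is -1. The scalar is the same for
          both actions and occurs twice, so it cancels.\<close>
        define d where "d = (if b \<otimes> b = \<one> then 1 else -1 :: 'k)"
        have dd: "d * d = 1" by (simp add: d_def)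
        have "r b (r b w) = scale d w"
          using Rr(10)[of w] w fixr[OF iB(1) w] iota lin_scale[OF Rr(2)] by (auto simp: d_def block_space_def)
        moreover have "s b (s b (f (\<iota>, 0) w)) = scale d (f (\<iota>, 0) w)"
          using Rs(10)[of "f (\<iota>, 0) w"] fw fixs[OF iB(1) fw] iota lin_scale[OF Rs(2)] by (auto simp: d_def block_space_def)
        moreover have "lin (f (\<iota>, 0))" using fg[OF iJ] by blast
        ultimately have "s b (s b (f (\<iota>, 0) (r b (r b w)))) = f (\<iota>, 0) w"
          using dd by (simp add: lin_scale lin_scale[OF Rs(3)])
        then have "s b (T v) = f (\<iota>, 0) w"
          using T(5)[OF that] 3 t5 by (simp add: w_def)
        then show ?thesis
          using T(5)[OF iB(1) w] block_index_facts[OF iota two] by (simp add: w_def t_def)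
      qed
    qed
    have "action_iso G E r s T S"
      by (rule action_isoI[OF is_group r s sr T(1-4,6) _ gens(3)]) (use gens Ta Tb in auto)
    then show "\<exists>T S. action_iso G E r s T S" by blast
  qed
qed

end

section \<open>Normal forms in the nonabelian groups of order 8\<close>

text \<open>Both the left multiplications in the group and the operators of a linear action satisfy these
  relations, so the multiplication rule for words \<open>a\<^sup>i b\<^sup>j\<close> is derived once for both.\<close>

locale dihedral_relations =
  fixes A B E :: "'x \<Rightarrow> 'x" and e :: nat
  assumes rel: "A (A (A (A v))) = E v" "B (A v) = A (A (A (B v)))" "B (B v) = (A ^^ e) (E v)"
    and unit: "A (E v) = A v" "B (E v) = B v" "E (A v) = A v" "E (B v) = B v" "E (E v) = E v"
begin

definition word :: "nat \<times> nat \<Rightarrow> 'x \<Rightarrow> 'x" where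
  "word p v = (A ^^ fst p) ((B ^^ snd p) (E v))"

text \<open>These are the exponents of the normal form: each pair of factors \<open>B\<close> is
  traded for \<open>e\<close> factors \<open>A\<close>, and four factors \<open>A\<close>
  disappear.\<close>

definition reduce :: "nat \<times> nat \<Rightarrow> nat \<times> nat" where
  "reduce p = ((fst p + e * (snd p div 2)) mod 4, snd p mod 2)"

lemma unit_A_power: "E v = v \<Longrightarrow> E ((A ^^ i) v) = (A ^^ i) v"
  by (cases i) (simp_all add: unit)

lemma unit_B_power: "E v = v \<Longrightarrow> E ((B ^^ i) v) = (B ^^ i) v"
  by (cases i) (simp_all add: unit)

lemma A_power_mod: "E v = v \<Longrightarrow> (A ^^ i) v = (A ^^ (i mod 4)) v"
proof (induction i rule: less_induct)
  case (less i)
  show ?case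
  proof (cases "i < 4")
    case False
    then obtain k where k: "i = 4 + k" using le_Suc_ex[of 4 i] by auto
    then have "(A ^^ i) v = (A ^^ k) v"
      using rel(1) unit_A_power less.prems by (simp add: funpow_add eval_nat_numeral)
    moreover have "i mod 4 = k mod 4" using k by simp
    ultimately show ?thesis using less.IH[of k] less.prems k by simp
  qed simp
qed

lemma B_power_div: "E v = v \<Longrightarrow> (B ^^ j) v = (A ^^ (e * (j div 2))) ((B ^^ (j mod 2)) v)"
proof (induction j rule: less_induct)
  case (less j)
  show ?case
  proof (cases "j < 2")
    case False
    then obtain k where k: "j = Suc (Suc k)" using le_Suc_ex[of 2 j] by auto
    have "(B ^^ j) v = (A ^^ e) ((B ^^ k) v)"
      using k rel(3) unit_B_power[OF less.prems] by simp
    also have "\<dots> = (A ^^ (e + e * (k div 2))) ((B ^^ (k mod 2)) v)"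
      using less.IH[of k] less.prems k by (simp add: funpow_add)
    finally show ?thesis using k by simp
  qed simp
qed

lemma B_A_power: "B ((A ^^ k) v) = (A ^^ (3 * k)) (B v)"
  by (induction k) (simp_all add: rel(2) numeral_3_eq_3)

lemma B_power_A_power: "(B ^^ j) ((A ^^ k) v) = (A ^^ (3 ^ j * k)) ((B ^^ j) v)"
  by (induction j) (simp_all add: B_A_power mult.assoc)

lemma unit_word: "E (word p v) = word p v" "word p (E v) = word p v"
  by (simp_all add: word_def unit unit_A_power unit_B_power)

lemma word_reduce: "word (reduce p) v = word p v"
proof -
  let ?w = "(B ^^ (snd p mod 2)) (E v)"
  have w: "E ?w = ?w" by (rule unit_B_power) (rule unit)
  have "word p v = (A ^^ (fst p + e * (snd p div 2))) ?w"
    using B_power_div[of "E v" "snd p"] by (simp add: word_def unit funpow_add)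
  then show ?thesis using A_power_mod[OF w, of "fst p + e * (snd p div 2)"] by (simp add: word_def reduce_def)
qed

text \<open>Each \<open>B\<close> that passes a power of \<open>A\<close> triples its exponent. The
  exponents are left unreduced, so the formula is the same for every \<open>e\<close>.\<close>

lemma word_mult: "word p (word q v) = word (fst p + 3 ^ snd p * fst q, snd p + snd q) v"
proof -
  have "word p (word q v) = (A ^^ fst p) ((B ^^ snd p) ((A ^^ fst q) ((B ^^ snd q) (E v))))"
    using unit_word(1)[of q v] by (simp add: word_def)
  then show ?thesis by (simp add: word_def B_power_A_power funpow_add)
qed

end

text \<open>The relations also hold in proper quotients. Uniqueness of the normal form excludes
  these and lets any operators satisfying the relations define an action.\<close>

locale nonabelian_presentation = nonabelian_generators +
  assumes normal_form: "bij_betw (\<lambda>(i::nat, j::nat). a [^] i \<otimes> b [^] j) ({..<4} \<times> {..<2}) (carrier G)"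
begin

definition square_exponent :: nat where
  "square_exponent = (if b \<otimes> b = \<one> then 0 else 2)"

text \<open>Continuing by the identity off the carrier makes the relations hold on the whole type,
  with \<open>id\<close> as the unit.\<close>

definition left_mult :: "'a \<Rightarrow> 'a \<Rightarrow> 'a" where
  "left_mult g x = (if x \<in> carrier G then g \<otimes> x else x)"

lemma left_mult_power:
  assumes "g \<in> carrier G" "x \<in> carrier G"
  shows "(left_mult g ^^ i) x = g [^] i \<otimes> x"
proof (induction i)
  case (Suc i)
  then show ?case
    using assms nat_pow_Suc2[OF assms(1), of i] by (simp add: left_mult_def m_assoc[symmetric] del: nat_pow_Suc)
qed (use assms in simp)

lemma dihedral_left_mult: "dihedral_relations (left_mult a) (left_mult b) id square_exponent"
proof
  note ab = gens(1,2)
  show "left_mult a (left_mult a (left_mult a (left_mult a v))) = id v" for v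
    using ab arg_cong[OF rels(1), of "\<lambda>x. x \<otimes> v"]
    by (cases "v \<in> carrier G") (simp_all add: left_mult_def m_assoc)
  show "left_mult b (left_mult a v) = left_mult a (left_mult a (left_mult a (left_mult b v)))" for v
    using ab arg_cong[OF rels(2), of "\<lambda>x. x \<otimes> v"]
    by (cases "v \<in> carrier G") (simp_all add: left_mult_def m_assoc)
  show "left_mult b (left_mult b v) = (left_mult a ^^ square_exponent) (id v)" for v
    using ab rels(3) by (auto simp: left_mult_def square_exponent_def numeral_2_eq_2 simp flip: m_assoc)
qed simp_all

interpretation L: dihedral_relations "left_mult a" "left_mult b" id square_exponent
  by (rule dihedral_left_mult)

abbreviation elem :: "nat \<times> nat \<Rightarrow> 'a" where
  "elem p \<equiv> a [^] fst p \<otimes> b [^] snd p"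

lemma word_elem: "L.word p x = elem p \<otimes> x" if "x \<in> carrier G"
  using gens(1,2) that by (simp add: L.word_def left_mult_power m_assoc)

lemma elem_reduce: "elem (L.reduce p) = elem p"
  using L.word_reduce[of p \<one>] word_elem[of \<one>] gens(1,2) by simp

lemma elem_mult: "elem p \<otimes> elem q = elem (fst p + 3 ^ snd p * fst q, snd p + snd q)"
  using L.word_mult[of p q \<one>] word_elem[of \<one>] word_elem[of "elem q"] gens(1,2) by simp

text \<open>This is the universal property of the presentation. An element acts by the word in
  \<open>A\<close> and \<open>B\<close> that spells it in \<open>a\<close> and \<open>b\<close>;
  this is multiplicative because words in the group and words in the operators obey the same product
  rule.\<close>

lemma linear_action_of_operators:
  fixes scale :: "'k::field \<Rightarrow> 'v::ab_group_add \<Rightarrow> 'v"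
  assumes V: "linear_endo scale"
    and lin: "Vector_Spaces.linear scale scale A" "Vector_Spaces.linear scale scale B"
      "Vector_Spaces.linear scale scale E"
    and rel: "dihedral_relations A B E square_exponent"
  obtains r where "linear_endo.linear_action scale G E r" "r a = A" "r b = B"
proof -
  interpret linear_endo scale by (rule V)
  interpret R: dihedral_relations A B E square_exponent by (rule rel)
  let ?box = "{..<4::nat} \<times> {..<2::nat}"
  define r where "r g = R.word (inv_into ?box elem g)" for g
  have bij: "bij_betw elem ?box (carrier G)"
    using normal_form by (simp add: case_prod_beta')
  \<comment> \<open>Any spelling may be used, not only the normal form: the reduction of exponents
    is literally the same in the group and for the operators.\<close>
  have r_elem: "r (elem p) = R.word p" for p
  proof -
    have "L.reduce p \<in> ?box" by (simp add: L.reduce_def)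
    then have "inv_into ?box elem (elem p) = L.reduce p"
      using bij_betw_inv_into_left[OF bij, of "L.reduce p"] elem_reduce[of p] by simp
    then show ?thesis using R.word_reduce by (simp add: r_def R.reduce_def L.reduce_def fun_eq_iff)
  qed
  have surj: "\<exists>p. g = elem p" if "g \<in> carrier G" for g
    using bij that by (metis (no_types, lifting) bij_betw_imp_surj_on imageE)
  have pow: "lin (f ^^ i)" if "lin f" for f i
    by (induction i) (use that in \<open>simp_all add: lin_iff\<close>)
  have linw: "lin (R.word p)" for p
    unfolding R.word_def by (intro lin_comp[OF pow[OF lin(1)]] lin_comp[OF pow[OF lin(2)]] lin(3))
  have "linear_action G E r"
    unfolding linear_action_def
  proof (intro conjI ballI allI)
    show "lin (r g)" if "g \<in> carrier G" for g
      using surj[OF that] r_elem linw by metis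
    show "r \<one> v = E v" for v
      using r_elem[of "(0, 0)"] by (simp add: R.word_def)
    show "r (g \<otimes> h) v = r g (r h v)" if gh: "g \<in> carrier G" "h \<in> carrier G" for g h v
    proof -
      obtain p q where pq: "g = elem p" "h = elem q" using surj gh by blast
      show ?thesis unfolding pq elem_mult r_elem R.word_mult ..
    qed
  qed
  moreover have "r a = A" "r b = B"
    using r_elem[of "(1, 0)"] r_elem[of "(0, 1)"] gens(1,2) by (auto simp: R.word_def R.unit fun_eq_iff)
  ultimately show thesis by (rule that)
qed

end

section \<open>Generators and relations of a nonabelian group of order 8\<close>

lemma (in group) comm_group_if_involutive:
  assumes "\<And>x. x \<in> carrier G \<Longrightarrow> x \<otimes> x = \<one>"
  shows "comm_group G"
proof (rule group_comm_groupI)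
  fix x y assume xy: "x \<in> carrier G" "y \<in> carrier G"
  have "inv z = z" if "z \<in> carrier G" for z using assms that inv_equality by blast
  then show "x \<otimes> y = y \<otimes> x" using inv_mult_group[OF xy] xy by (metis m_closed)
qed

text \<open>If all squares were trivial, or some element had order 8, the group would be abelian; so
  there is an \<open>a\<close> of order 4. Any \<open>b\<close> outside its powers fills the other
  coset, which gives the normal form. Then \<open>b \<otimes> a\<close> is some power of
  \<open>a\<close> times \<open>b\<close>, and \<open>b \<otimes> b\<close> is a power of
  \<open>a\<close>; the two exponents are found by elimination.\<close>

lemma (in group) nonabelian_order_8:
  assumes ord: "Coset.order G = 8" and nc: "\<not> comm_group G"
  obtains a b where "nonabelian_presentation G a b"
proof -
  have fin: "finite (carrier G)" using ord order_gt_0_iff_finite by simp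
  obtain a where a: "a \<in> carrier G" "a \<otimes> a \<noteq> \<one>"
    using comm_group_if_involutive nc by blast
  have pa: "a [^] i \<in> carrier G" for i :: nat using a by simp
  have pow_mod: "a [^] i = a [^] (i mod ord a)" for i
  proof -
    have "a [^] i = (a [^] ord a) [^] (i div ord a) \<otimes> a [^] (i mod ord a)"
      using a(1) by (simp only: nat_pow_pow nat_pow_mult mult_div_mod_eq)
    then show ?thesis using a(1) by simp
  qed
  have ord_dvd: "ord a dvd 8" using ord ord_dvd_group_order[OF a(1)] by simp
  have "\<not> ord a dvd 2" using a pow_eq_id[OF a(1), of 2] by (simp add: numeral_2_eq_2)
  moreover have "ord a = 1 \<or> ord a = 2 \<or> ord a = 4 \<or> ord a = 8"
  proof -
    have "ord a \<le> 8" using ord_dvd by (rule dvd_imp_le) simp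
    then have "ord a \<in> {0,1,2,3,4,5,6,7,8}" by auto
    then show ?thesis using ord_dvd by auto
  qed
  ultimately have "ord a = 4 \<or> ord a = 8" by auto
  have inj: "inj_on (\<lambda>i::nat. a [^] i) {..<ord a}"
    using ord_inj[OF a(1)] by (rule inj_on_subset) auto
  have ord4: "ord a = 4"
  proof (rule ccontr)
    assume "ord a \<noteq> 4"
    then have "card ((\<lambda>i::nat. a [^] i) ` {..<ord a}) = card (carrier G)"
      using \<open>ord a = 4 \<or> ord a = 8\<close> ord card_image[OF inj] by (simp add: Coset.order_def)
    then have all: "(\<lambda>i::nat. a [^] i) ` {..<ord a} = carrier G"
      using card_subset_eq[OF fin] pa by blast
    have "comm_group G"
    proof (rule group_comm_groupI)
      fix x y assume "x \<in> carrier G" "y \<in> carrier G"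
      then obtain i j :: nat where "x = a [^] i" "y = a [^] j" using all by blast
      then show "x \<otimes> y = y \<otimes> x" using a by (simp add: nat_pow_mult add.commute)
    qed
    then show False using nc by blast
  qed
  note inj = inj[unfolded ord4] and pow_mod = pow_mod[unfolded ord4]
  have a4: "a [^] (4 * i) = \<one>" for i :: nat using pow_mod[of "4 * i"] by simp
  let ?H = "(\<lambda>i::nat. a [^] i) ` {..<4}"
  have H: "a [^] i \<in> ?H" for i :: nat using pow_mod[of i] by auto
  have "card ?H = 4" using card_image[OF inj] by simp
  then have "\<not> carrier G \<subseteq> ?H"
    using ord card_mono[of ?H "carrier G"] by (auto simp: Coset.order_def)
  then obtain b where b: "b \<in> carrier G" "b \<notin> ?H" by blast
  have lc: "x = y" if "b \<otimes> x = b \<otimes> y" "x \<in> carrier G" "y \<in> carrier G" for x y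
    using Units_l_cancel[of b x y] b(1) that by simp
  have cancel_left: "x \<in> ?H" if "a [^] i \<otimes> x = a [^] j" "x \<in> carrier G" for x and i j :: nat
  proof -
    \<comment> \<open>The exponent \<open>3 * i\<close> inverts the exponent \<open>i\<close> modulo
      4, so natural exponents suffice.\<close>
    have "a [^] (3 * i + j) = a [^] (3 * i) \<otimes> (a [^] i \<otimes> x)" using that a by (simp add: nat_pow_mult)
    also have "\<dots> = a [^] (4 * i) \<otimes> x"
      using that(2) a by (simp add: nat_pow_mult m_assoc[symmetric])
    finally show ?thesis using a4 that(2) H by (metis l_one)
  qed
  have cancel_right: "x \<in> ?H" if "x \<otimes> a = a [^] j" "x \<in> carrier G" for x and j :: nat
  proof -
    have "a [^] (j + 3) = x \<otimes> a \<otimes> a [^] (3::nat)" using that a by (simp add: nat_pow_mult)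
    also have "\<dots> = x \<otimes> a [^] (4 * 1 :: nat)"
      using that(2) a nat_pow_Suc2[OF a(1), of 3] by (simp add: m_assoc eval_nat_numeral)
    finally show ?thesis using a4[of 1] that(2) H by (metis r_one)
  qed
  define f where "f = (\<lambda>(i::nat, j::nat). a [^] i \<otimes> b [^] j)"
  let ?box = "{..<4::nat} \<times> {..<2::nat}"
  have f0: "f (i, 0) = a [^] i" and f1: "f (i, 1) = a [^] i \<otimes> b" for i
    using a b by (simp_all add: f_def)
  have fH: "a [^] i \<otimes> b \<noteq> a [^] j" for i j :: nat using cancel_left b by blast
  have box: "p \<in> ?box \<Longrightarrow> \<exists>i<4. p = (i, 0) \<or> p = (i, 1)" for p by (cases p) (auto simp: less_2_cases_iff)
  have inj_f: "inj_on f ?box"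
  proof (rule inj_onI)
    fix p q assume p: "p \<in> ?box" and q: "q \<in> ?box" and eq: "f p = f q"
    obtain i k where ik: "i < 4" "p = (i, 0) \<or> p = (i, 1)" "k < 4" "q = (k, 0) \<or> q = (k, 1)"
      using box p q by meson
    have "a [^] i = a [^] k \<Longrightarrow> i = k" using inj ik by (auto dest: inj_onD)
    then show "p = q"
      using ik(2,4) eq fH[of i k] fH[of k i] pa b(1) by (auto simp: f0 f1 simp del: One_nat_def)
  qed
  have "f ` ?box \<subseteq> carrier G" using a b by (auto simp: f_def)
  moreover have "card (f ` ?box) = card (carrier G)"
    using card_image[OF inj_f] ord by (simp add: Coset.order_def)
  ultimately have range_f: "f ` ?box = carrier G" using card_subset_eq[OF fin] by blast
  have form: "\<exists>i<4::nat. x = a [^] i \<or> x = a [^] i \<otimes> b" if "x \<in> carrier G" for x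
  proof -
    obtain p where "p \<in> ?box" "x = f p" using \<open>x \<in> carrier G\<close> unfolding range_f[symmetric] by blast
    then show ?thesis using box[of p] f0 f1 by metis
  qed
  obtain k :: nat where k: "k < 4" "b \<otimes> a = a [^] k \<otimes> b"
    using form[of "b \<otimes> a"] cancel_right[of b] a b by auto
  have "k \<noteq> 0"
  proof
    assume "k = 0"
    then have "b \<otimes> a = b \<otimes> \<one>" using k b by simp
    then have "a = \<one>" using lc a(1) by blast
    then show False using a by simp
  qed
  \<comment> \<open>With exponent 1 the generators would commute, and by the normal form so would
    all elements.\<close>
  moreover have "k \<noteq> 1"
  proof
    assume "k = 1"
    then have ba: "b \<otimes> a = a \<otimes> b" using k a by simp
    have bp: "b \<otimes> a [^] i = a [^] i \<otimes> b" for i :: nat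
    proof (induction i)
      case (Suc i)
      have "b \<otimes> a [^] Suc i = (b \<otimes> a [^] i) \<otimes> a" using a b by (simp add: m_assoc)
      also have "\<dots> = a [^] i \<otimes> (b \<otimes> a)" using Suc a b by (simp add: m_assoc)
      finally show ?case using ba a b by (simp add: m_assoc)
    qed (use b in simp)
    have A: "a [^] i \<otimes> x = x \<otimes> a [^] i" if x: "x \<in> carrier G" for x and i :: nat
    proof -
      obtain j :: nat where "x = a [^] j \<or> x = a [^] j \<otimes> b" using form[OF x] by blast
      then show ?thesis
      proof
        assume j: "x = a [^] j \<otimes> b"
        have "x \<otimes> a [^] i = a [^] j \<otimes> (b \<otimes> a [^] i)" unfolding j using pa b(1) by (simp add: m_assoc)
        also have "\<dots> = a [^] j \<otimes> (a [^] i \<otimes> b)" unfolding bp ..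
        also have "\<dots> = a [^] i \<otimes> (a [^] j \<otimes> b)"
          using a b(1) by (simp add: nat_pow_mult add.commute flip: m_assoc)
        finally show ?thesis using j by simp
      qed (use a in \<open>simp add: nat_pow_mult add.commute\<close>)
    qed
    have B: "b \<otimes> x = x \<otimes> b" if x: "x \<in> carrier G" for x
    proof -
      obtain j :: nat where "x = a [^] j \<or> x = a [^] j \<otimes> b" using form[OF x] by blast
      then show ?thesis using bp[of j] pa[of j] b(1) by (auto simp: m_assoc[symmetric])
    qed
    have "x \<otimes> y = y \<otimes> x" if xy: "x \<in> carrier G" "y \<in> carrier G" for x y
    proof -
      obtain i :: nat where "x = a [^] i \<or> x = a [^] i \<otimes> b" using form[OF xy(1)] by blast
      then show ?thesis
      proof
        assume i: "x = a [^] i \<otimes> b"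
        have "x \<otimes> y = a [^] i \<otimes> (y \<otimes> b)" unfolding i B[OF xy(2), symmetric] using pa b(1) xy(2) by (simp add: m_assoc)
        also have "\<dots> = (y \<otimes> a [^] i) \<otimes> b" unfolding A[OF xy(2), symmetric] using pa b(1) xy(2) by (simp add: m_assoc)
        finally show ?thesis using i pa b(1) xy(2) by (simp add: m_assoc)
      next
        assume "x = a [^] i"
        then show ?thesis using A[OF xy(2), of i] by simp
      qed
    qed
    then have "comm_group G" by (rule group_comm_groupI)
    then show False using nc by blast
  qed
  \<comment> \<open>With exponent 2, moving \<open>b\<close> past \<open>a \<otimes> a\<close> would
    give the fourth power of \<open>a\<close>, forcing
    \<open>a \<otimes> a = \<one>\<close>.\<close>
  moreover have "k \<noteq> 2"
  proof
    assume "k = 2"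
    have "b \<otimes> (a \<otimes> a) = b \<otimes> a \<otimes> a" using a(1) b(1) by (simp add: m_assoc)
    also have "\<dots> = a [^] (2::nat) \<otimes> (b \<otimes> a)" using k \<open>k = 2\<close> a(1) b(1) pa by (simp add: m_assoc)
    also have "\<dots> = a [^] (2::nat) \<otimes> a [^] (2::nat) \<otimes> b" using k \<open>k = 2\<close> a b pa by (simp add: m_assoc)
    also have "\<dots> = b \<otimes> \<one>" using a4[of 1] a(1) b(1) by (simp add: nat_pow_mult)
    finally have "a \<otimes> a = \<one>" using lc a(1) by blast
    then show False using a by simp
  qed
  ultimately have ba: "b \<otimes> a = a [^] (3::nat) \<otimes> b" using k by (cases "k = 3") auto
  have bp: "b \<otimes> a [^] i = a [^] (3 * i) \<otimes> b" for i :: nat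
  proof (induction i)
    case (Suc i)
    have "b \<otimes> a [^] Suc i = (b \<otimes> a [^] i) \<otimes> a" using a b by (simp add: m_assoc)
    also have "\<dots> = a [^] (3 * i) \<otimes> (b \<otimes> a)" using Suc a b by (simp add: m_assoc)
    also have "\<dots> = a [^] (3 * i) \<otimes> a [^] (3::nat) \<otimes> b" using ba a b by (simp add: m_assoc)
    also have "\<dots> = a [^] (3 * Suc i) \<otimes> b" using a by (simp only: nat_pow_mult) (simp add: add.commute)
    finally show ?case .
  qed (use b in simp)
  obtain l :: nat where l: "l < 4" "b \<otimes> b = a [^] l"
  proof -
    obtain l' :: nat where l': "l' < 4" "b \<otimes> b = a [^] l' \<or> b \<otimes> b = a [^] l' \<otimes> b"
      using form[OF m_closed[OF b(1) b(1)]] by blast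
    moreover have "b \<otimes> b \<noteq> a [^] l' \<otimes> b" using b pa[of l'] H[of l'] right_cancel[of b b "a [^] l'"] by auto
    ultimately show ?thesis using that[of l'] by simp
  qed
  \<comment> \<open>\<open>b\<close> commutes with its own square, while passing a power of
    \<open>a\<close> triples the exponent. Modulo 4 this leaves only the exponents 0 and 2.\<close>
  have "a [^] (3 * l) \<otimes> b = a [^] l \<otimes> b" using bp[of l] l b by (metis m_assoc)
  then have "a [^] (3 * l) = a [^] l" using pa b(1) by (metis right_cancel)
  then have "a [^] (3 * l mod 4) = a [^] l" using pow_mod by metis
  then have "3 * l mod 4 = l" using inj l by (auto dest: inj_onD)
  moreover have "l = 0 \<or> l = 1 \<or> l = 2 \<or> l = 3" using l by linarith
  ultimately have "l = 0 \<or> l = 2" by auto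
  have "carrier G \<subseteq> generate G {a, b}"
  proof
    have sub: "subgroup (generate G {a, b}) G" using generate_is_subgroup a b by simp
    have pow: "a [^] i \<in> generate G {a, b}" for i :: nat
      by (induction i) (use sub in \<open>auto intro: generate.one generate.eng generate.incl\<close>)
    fix x assume "x \<in> carrier G"
    then show "x \<in> generate G {a, b}"
      using form pow generate.eng[OF pow generate.incl[of b "{a, b}"]] by fastforce
  qed
  then have gen: "generate G {a, b} = carrier G"
    using generate_incl[of "{a, b}"] a b by auto
  show thesis
  proof (rule that[of a b], unfold_locales)
    show "bij_betw (\<lambda>(i::nat, j::nat). a [^] i \<otimes> b [^] j) ?box (carrier G)"
      using inj_f range_f by (simp add: bij_betw_def f_def)
    show "a \<otimes> (a \<otimes> (a \<otimes> a)) = \<one>" using a4[of 1] a(1) by (simp add: eval_nat_numeral m_assoc)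
    show "b \<otimes> a = a \<otimes> (a \<otimes> (a \<otimes> b))" using ba a(1) b(1) by (simp add: eval_nat_numeral m_assoc)
    show "b \<otimes> b = \<one> \<or> b \<otimes> b = a \<otimes> a" using l \<open>l = 0 \<or> l = 2\<close> a(1) by (auto simp: eval_nat_numeral)
  qed (use a b gen in auto)
qed

section \<open>Actions with prescribed multiplicities\<close>

definition scale_fun :: "'k::field \<Rightarrow> (nat \<Rightarrow> 'k) \<Rightarrow> nat \<Rightarrow> 'k" where
  "scale_fun c f = (\<lambda>i. c * f i)"

definition truncate :: "nat \<Rightarrow> (nat \<Rightarrow> 'k::field) \<Rightarrow> nat \<Rightarrow> 'k" where
  "truncate n f = (\<lambda>i. if i < n then f i else 0)"

definition coordinate_space :: "nat set \<Rightarrow> (nat \<Rightarrow> 'k::field) set" where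
  "coordinate_space S = {f. \<forall>i. i \<notin> S \<longrightarrow> f i = 0}"

global_interpretation FS: linear_endo scale_fun
  by unfold_locales (simp_all add: scale_fun_def fun_eq_iff algebra_simps)

lemma sum_fun_apply: "(\<Sum>x\<in>A. f x) i = (\<Sum>x\<in>A. f x i)" for f :: "'x \<Rightarrow> 'y \<Rightarrow> 'z::comm_monoid_add"
  by (induction A rule: infinite_finite_induct) simp_all

definition unit_fun :: "nat \<Rightarrow> nat \<Rightarrow> 'k::field" where
  "unit_fun i = (\<lambda>j. if j = i then 1 else 0)"

lemma coordinate_space_expand:
  assumes "finite S" "f \<in> coordinate_space S"
  shows "f = (\<Sum>i\<in>S. scale_fun (f i) (unit_fun i))"
proof
  fix j
  have "(\<Sum>i\<in>S. scale_fun (f i) (unit_fun i)) j = (\<Sum>i\<in>S. if i = j then f j else 0)"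
    unfolding sum_fun_apply by (rule sum.cong) (auto simp: scale_fun_def unit_fun_def)
  then show "f j = (\<Sum>i\<in>S. scale_fun (f i) (unit_fun i)) j"
    using assms by (simp add: coordinate_space_def)
qed

lemma coordinate_space_subset_span:
  assumes "finite S"
  shows "(coordinate_space S :: (nat \<Rightarrow> 'k::field) set) \<subseteq> FS.span (unit_fun ` S)"
proof
  fix f :: "nat \<Rightarrow> 'k" assume "f \<in> coordinate_space S"
  then show "f \<in> FS.span (unit_fun ` S)"
    by (subst coordinate_space_expand[OF assms])
      (auto intro: FS.span_sum FS.span_scale FS.span_base)
qed

lemma dim_coordinate_space:
  assumes "finite S"
  shows "FS.dim (coordinate_space S :: (nat \<Rightarrow> 'k::field) set) = card S"
proof (rule FS.dim_unique)
  let ?e = "unit_fun :: nat \<Rightarrow> nat \<Rightarrow> 'k"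
  have inj: "inj ?e" by (auto simp: inj_def unit_fun_def fun_eq_iff split: if_splits)
  show "?e ` S \<subseteq> coordinate_space S" by (auto simp: unit_fun_def coordinate_space_def)
  show "coordinate_space S \<subseteq> FS.span (?e ` S)" by (rule coordinate_space_subset_span[OF assms])
  show "FS.independent (?e ` S)"
  proof (rule FS.independent_if_scalars_zero)
    fix c :: "(nat \<Rightarrow> 'k) \<Rightarrow> 'k" and x
    assume sum: "(\<Sum>x\<in>?e ` S. scale_fun (c x) x) = 0" and "x \<in> ?e ` S"
    then obtain j where j: "j \<in> S" "x = ?e j" by blast
    have "0 = (\<Sum>i\<in>S. scale_fun (c (?e i)) (?e i)) j"
      using sum by (subst (asm) sum.reindex) (use inj in \<open>auto simp: inj_on_def inj_def\<close>)
    also have "\<dots> = (\<Sum>i\<in>S. if i = j then c (?e j) else 0)"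
      unfolding sum_fun_apply by (rule sum.cong) (auto simp: scale_fun_def unit_fun_def)
    finally show "c x = 0" using assms j by simp
  qed (use assms in simp)
  show "card (?e ` S) = card S" using inj by (simp add: card_image inj_on_def inj_def)
qed

lemma range_truncate: "range (truncate n) = (coordinate_space {..<n} :: (nat \<Rightarrow> 'k::field) set)"
proof
  show "range (truncate n) \<subseteq> coordinate_space {..<n}" by (auto simp: truncate_def coordinate_space_def)
  show "(coordinate_space {..<n} :: (nat \<Rightarrow> 'k) set) \<subseteq> range (truncate n)"
  proof
    fix f :: "nat \<Rightarrow> 'k" assume "f \<in> coordinate_space {..<n}"
    then have "f = truncate n f" by (auto simp: truncate_def coordinate_space_def fun_eq_iff)
    then show "f \<in> range (truncate n)" by blast
  qed
qed

lemma range_truncate_span: "range (truncate n) \<subseteq> FS.span (unit_fun ` {..<n})"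
  unfolding range_truncate by (rule coordinate_space_subset_span) simp

lemma dim_range_truncate: "FS.dim (range (truncate n)) = n"
  by (simp add: range_truncate dim_coordinate_space)

text \<open>The colour of a coordinate will be the type by which the group acts on it; the class
  sizes are the prescribed multiplicities.\<close>

lemma exists_coloring:
  fixes m :: "'i \<Rightarrow> nat"
  assumes "finite I"
  shows "\<exists>c. (\<forall>j<(\<Sum>i\<in>I. m i). c j \<in> I) \<and> (\<forall>i\<in>I. card {j. j < (\<Sum>i\<in>I. m i) \<and> c j = i} = m i)"
  using assms
proof (induction I rule: finite_induct)
  case (insert x F)
  let ?N = "\<Sum>i\<in>F. m i"
  obtain c where c: "\<forall>j<?N. c j \<in> F" "\<forall>i\<in>F. card {j. j < ?N \<and> c j = i} = m i"
    using insert.IH by blast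
  define d where "d j = (if j < ?N then c j else x)" for j
  have "{j. j < m x + ?N \<and> d j = i} = {j. j < ?N \<and> c j = i}" if "i \<in> F" for i
    using that insert.hyps(2) by (auto simp: d_def)
  moreover have "{j. j < m x + ?N \<and> d j = x} = {?N..<m x + ?N}"
    using c(1) insert.hyps(2) by (auto simp: d_def not_less)
  ultimately show ?case
    using insert.hyps c by (intro exI[of _ d]) (auto simp: d_def)
qed simp

lemma exists_map_eq:
  assumes "distinct xs" "length l = length xs"
  obtains m where "map m xs = l"
proof
  show "map (\<lambda>x. the (map_of (zip xs l) x)) xs = l"
    using assms by (intro nth_equalityI) (simp_all add: map_of_zip_nth)
qed

text \<open>The action is diagonal: coordinate \<open>j\<close> is scaled by the character
  \<open>c j\<close>, so a weight space consists of the sequences supported on one colour.\<close>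

lemma exists_abelian_action:
  fixes xs :: "('g \<Rightarrow> 'k::field) list"
  assumes G: "group G"
    and xs: "distinct xs" "set xs = characters G (carrier G)"
    and l: "length l = length xs" "sum_list l = n"
  obtains r where "FS.linear_action G (truncate n) r"
    "map (\<lambda>\<chi>. FS.dim (FS.weight_space G r \<chi>)) xs = l"
proof -
  obtain m where m: "map m xs = l" using exists_map_eq[OF xs(1) l(1)] .
  have n: "(\<Sum>\<chi>\<in>set xs. m \<chi>) = n" using xs(1) l(2) m by (simp flip: sum_list_distinct_conv_sum_set)
  obtain c where c: "\<And>j. j < n \<Longrightarrow> c j \<in> set xs" "\<And>\<chi>. \<chi> \<in> set xs \<Longrightarrow> card {j. j < n \<and> c j = \<chi>} = m \<chi>"
    using exists_coloring[of "set xs" m] n by auto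
  define r where "r g f = (\<lambda>j. if j < n then c j g * f j else 0)" for g and f :: "nat \<Rightarrow> 'k"
  have cj: "c j \<in> characters G (carrier G)" if "j < n" for j using c(1)[OF that] xs(2) by simp
  have "FS.linear_action G (truncate n) r"
    unfolding FS.linear_action_def
  proof (intro conjI ballI allI)
    show "FS.lin (r g)" for g
      by (simp add: FS.lin_iff r_def scale_fun_def fun_eq_iff algebra_simps)
    show "r \<one>\<^bsub>G\<^esub> v = truncate n v" for v
      using charactersD(2)[OF cj] by (simp add: r_def truncate_def fun_eq_iff)
    show "r (g \<otimes>\<^bsub>G\<^esub> h) v = r g (r h v)" if "g \<in> carrier G" "h \<in> carrier G" for g h v
      using charactersD(3)[OF cj] that by (simp add: r_def fun_eq_iff)
  qed
  moreover have "FS.dim (FS.weight_space G r \<chi>) = m \<chi>" if \<chi>: "\<chi> \<in> set xs" for \<chi>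
  proof -
    have "FS.weight_space G r \<chi> = coordinate_space {j. j < n \<and> c j = \<chi>}"
    proof (intro equalityI subsetI)
      fix v :: "nat \<Rightarrow> 'k" assume v: "v \<in> FS.weight_space G r \<chi>"
      have "v j = 0" if j: "\<not> (j < n \<and> c j = \<chi>)" for j
      proof (cases "j < n")
        case True
        then obtain g where g: "g \<in> carrier G" "c j g \<noteq> \<chi> g"
          using j charactersD(1)[OF cj[OF True]] charactersD(1)[of \<chi> G "carrier G"] \<chi> xs(2)
          by (metis extensionalityI)
        have "r g v j = \<chi> g * v j" using v g(1) by (simp add: FS.weight_space_def scale_fun_def)
        then show ?thesis using True g(2) by (simp add: r_def)
      next
        case False
        \<comment> \<open>Beyond \<open>n\<close> every operator gives 0, while the unit must act on
          a weight vector by 1.\<close>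
        have "r \<one>\<^bsub>G\<^esub> v j = \<chi> \<one>\<^bsub>G\<^esub> * v j"
          using v group.is_monoid[OF G] monoid.one_closed by (fastforce simp: FS.weight_space_def scale_fun_def)
        then show ?thesis using False charactersD(2)[of \<chi> G] \<chi> xs(2) by (auto simp: r_def)
      qed
      then show "v \<in> coordinate_space {j. j < n \<and> c j = \<chi>}" by (simp add: coordinate_space_def)
    next
      fix v :: "nat \<Rightarrow> 'k" assume "v \<in> coordinate_space {j. j < n \<and> c j = \<chi>}"
      then have "v j = 0" if "\<not> (j < n \<and> c j = \<chi>)" for j
        using that by (simp add: coordinate_space_def)
      then show "v \<in> FS.weight_space G r \<chi>"
        by (auto simp: FS.weight_space_def scale_fun_def r_def fun_eq_iff)
    qed
    then show ?thesis using dim_coordinate_space[of "{j. j < n \<and> c j = \<chi>}"] c(2)[OF \<chi>] by simp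
  qed
  ultimately show thesis using that m by (metis (no_types, lifting) map_cong)
qed

context nonabelian_presentation
begin

text \<open>Here \<open>a\<close> is diagonal with entries \<alpha>, and \<open>b\<close> is
  monomial: it permutes coordinates by the involution \<tau> and multiplies by the weights \<beta>.
  The group relations become identities between these entries.\<close>

lemma exists_nonabelian_action:
  fixes \<iota> :: "'k::field"
  assumes iota: "\<iota> * \<iota> = -1" and two: "(2::'k) \<noteq> 0"
    and xs: "xs = [(1, 1), (1, -1), (-1, 1), (-1, -1)]"
    and l: "length l = 4" "sum_list l + 2 * s = n"
  obtains r where "FS.linear_action G (truncate n) r"
    "map (\<lambda>p. FS.dim (FS.block_space a b r p)) xs = l" "FS.dim (FS.block_space a b r (\<iota>, 0)) = s"
proof -
  note facts = block_index_facts[OF iota two]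
  have dist: "distinct xs" using facts(1) by (simp add: xs)
  obtain m where m: "map m xs = l" using exists_map_eq[OF dist, of l] l(1) by (auto simp: xs)
  have n: "(\<Sum>\<chi>\<in>set xs. m \<chi>) = n - 2 * s" "2 * s \<le> n"
    using l(2) m sum_list_distinct_conv_sum_set[OF dist, of m] by simp_all
  obtain c where c: "\<And>j. j < n - 2 * s \<Longrightarrow> c j \<in> set xs"
      "\<And>p. p \<in> set xs \<Longrightarrow> card {j. j < n - 2 * s \<and> c j = p} = m p"
    using exists_coloring[of "set xs" m] n by auto
  \<comment> \<open>The first \<open>2 * s\<close> coordinates carry \<open>s\<close> copies of the two-dimensional representation,
    coordinate \<open>2 * i\<close> being paired with \<open>2 * i + 1\<close>.\<close>
  define d where "d = (if b \<otimes> b = \<one> then 1 else -1 :: 'k)"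
  define \<alpha> where "\<alpha> j = (if j < 2 * s then if even j then \<iota> else -\<iota> else fst (c (j - 2 * s)))" for j
  \<comment> \<open>The weights 1 and \<open>d\<close> of a swapped pair multiply to
    \<open>d\<close>, the value that the square of \<open>b\<close> must have there: 1, or the
    square of \<iota>.\<close>
  define \<beta> where "\<beta> j = (if j < 2 * s then if even j then 1 else d else snd (c (j - 2 * s)))" for j
  define \<tau> where "\<tau> j = (if j < 2 * s then if even j then j + 1 else j - 1 else j)" for j
  define A where "A f = (\<lambda>j. if j < n then \<alpha> j * f j else 0)" for f :: "nat \<Rightarrow> 'k"
  define B where "B f = (\<lambda>j. if j < n then \<beta> j * f (\<tau> j) else 0)" for f :: "nat \<Rightarrow> 'k"
  have \<tau>: "\<tau> j < n" "\<tau> (\<tau> j) = j" if "j < n" for j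
  proof -
    show "\<tau> (\<tau> j) = j" by (auto simp: \<tau>_def elim!: oddE evenE)
    show "\<tau> j < n" using that n(2) by (auto simp: \<tau>_def elim!: oddE evenE)
  qed
  have c_cases: "j < n \<Longrightarrow> \<not> j < 2 * s \<Longrightarrow> c (j - 2 * s) \<in> set xs" for j
    using c(1)[of "j - 2 * s"] by simp
  have sq: "fst p * fst p = 1" "snd p * snd p = 1" if "p \<in> set xs" for p
    using that by (auto simp: xs)
  have \<alpha>: "\<alpha> j * (\<alpha> j * (\<alpha> j * \<alpha> j)) = 1" "\<alpha> (\<tau> j) = \<alpha> j * (\<alpha> j * \<alpha> j)" if "j < n" for j
  proof -
    have "\<alpha> j * \<alpha> j = (if j < 2 * s then -1 else 1)"
      using sq(1)[OF c_cases[OF that]] iota by (auto simp: \<alpha>_def)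
    then show "\<alpha> j * (\<alpha> j * (\<alpha> j * \<alpha> j)) = 1" "\<alpha> (\<tau> j) = \<alpha> j * (\<alpha> j * \<alpha> j)"
      using iota by (auto simp: \<alpha>_def \<tau>_def elim!: oddE evenE)
  qed
  have \<beta>: "\<beta> j * \<beta> (\<tau> j) = (if j < 2 * s then d else 1)" if "j < n" for j
    using sq(2)[OF c_cases[OF that]] by (auto simp: \<beta>_def \<tau>_def elim!: oddE evenE)
  have \<alpha>2: "\<alpha> j * \<alpha> j = (if j < 2 * s then -1 else 1)" if "j < n" for j
    using sq(1)[OF c_cases[OF that]] iota by (auto simp: \<alpha>_def)
  have rel: "dihedral_relations A B (truncate n) square_exponent"
  proof
    show "A (A (A (A v))) = truncate n v" for v
      using \<alpha>(1) by (simp add: A_def truncate_def fun_eq_iff flip: mult.assoc)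
    show "B (A v) = A (A (A (B v)))" for v
      using \<alpha>(2) \<tau> by (simp add: A_def B_def fun_eq_iff mult_ac)
    show "B (B v) = (A ^^ square_exponent) (truncate n v)" for v
      using \<beta> \<alpha>2 \<tau> by (simp add: A_def B_def truncate_def fun_eq_iff square_exponent_def d_def eval_nat_numeral flip: mult.assoc)
  qed (use \<tau> in \<open>simp_all add: A_def B_def truncate_def fun_eq_iff\<close>)
  have lin: "FS.lin A" "FS.lin B" "FS.lin (truncate n)"
    by (simp_all add: FS.lin_iff A_def B_def truncate_def scale_fun_def fun_eq_iff algebra_simps)
  obtain r where r: "FS.linear_action G (truncate n) r" "r a = A" "r b = B"
    using linear_action_of_operators[OF FS.linear_endo_axioms lin rel] by blast
  have dims: "FS.dim (FS.block_space a b r p) = m p" if p: "p \<in> set xs" for p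
  proof -
    let ?S = "(\<lambda>j. j + 2 * s) ` {j. j < n - 2 * s \<and> c j = p}"
    have S: "j \<in> ?S \<longleftrightarrow> j < n \<and> 2 * s \<le> j \<and> c (j - 2 * s) = p" for j
      by (auto simp: image_iff intro!: exI[of _ "j - 2 * s"])
    have p0: "snd p \<noteq> 0" "fst p = 1 \<or> fst p = -1" "fst p \<noteq> 0" using p by (auto simp: xs)
    have "FS.block_space a b r p = coordinate_space ?S"
    proof (intro equalityI subsetI)
      fix v :: "nat \<Rightarrow> 'k" assume "v \<in> FS.block_space a b r p"
      then have v: "A v j = fst p * v j" "B v j = snd p * v j" for j
        using p0 r by (simp_all add: FS.block_space_def scale_fun_def)
      have "v j = 0" if "j \<notin> ?S" for j
      proof -
        consider "\<not> j < n" | "j < 2 * s" "j < n" | "j < n" "2 * s \<le> j" "c (j - 2 * s) \<noteq> p"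
          using \<open>j \<notin> ?S\<close> S by force
        then show ?thesis
        proof cases
          case 1
          then show ?thesis using v(1)[of j] p0 by (simp add: A_def)
        next
          case 2
          then have "\<alpha> j \<noteq> fst p" using p0 facts by (auto simp: \<alpha>_def)
          then show ?thesis using v(1)[of j] 2 by (simp add: A_def)
        next
          case 3
          then have "\<alpha> j \<noteq> fst p \<or> \<beta> j \<noteq> snd p" by (auto simp: \<alpha>_def \<beta>_def prod_eq_iff)
          then show ?thesis using v[of j] 3 by (auto simp: A_def B_def \<tau>_def)
        qed
      qed
      then show "v \<in> coordinate_space ?S" by (simp add: coordinate_space_def)
    next
      fix v :: "nat \<Rightarrow> 'k" assume v: "v \<in> coordinate_space ?S"
      have z: "v j = 0" if "\<not> (j < n \<and> 2 * s \<le> j \<and> c (j - 2 * s) = p)" for j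
        using v that S unfolding coordinate_space_def by blast
      have "A v j = fst p * v j" "B v j = snd p * v j" for j
      proof -
        have "v (\<tau> j) = 0 \<and> v j = 0" if "j < 2 * s"
          using that by (auto simp: \<tau>_def elim!: evenE intro!: z)
        then show "A v j = fst p * v j" "B v j = snd p * v j"
          using z[of j] by (cases "j < 2 * s"; cases "c (j - 2 * s) = p"; simp add: A_def B_def \<alpha>_def \<beta>_def \<tau>_def)+
      qed
      then show "v \<in> FS.block_space a b r p"
        using r by (simp add: FS.block_space_def scale_fun_def fun_eq_iff)
    qed
    moreover have "card ?S = m p" using c(2)[OF p] by (simp add: card_image)
    ultimately show ?thesis using dim_coordinate_space[of ?S] by simp
  qed
  have "FS.dim (FS.block_space a b r (\<iota>, 0)) = s"
  proof -
    let ?S = "(\<lambda>i. 2 * i) ` {..<s}"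
    have S: "j \<in> ?S \<longleftrightarrow> j < 2 * s \<and> even j" for j by (auto elim!: evenE)
    have "FS.block_space a b r (\<iota>, 0) = coordinate_space ?S"
    proof (intro equalityI subsetI)
      fix v :: "nat \<Rightarrow> 'k" assume "v \<in> FS.block_space a b r (\<iota>, 0)"
      then have v: "A v j = \<iota> * v j" for j
        using r by (simp add: FS.block_space_def scale_fun_def)
      have "v j = 0" if "j \<notin> ?S" for j
      proof (cases "j < n")
        case True
        have "\<alpha> j \<noteq> \<iota>"
          using that S[of j] facts c_cases[OF True] by (auto simp: \<alpha>_def xs)
        then show ?thesis using v[of j] True by (simp add: A_def)
      next
        case False
        then show ?thesis using v[of j] facts by (simp add: A_def)
      qed
      then show "v \<in> coordinate_space ?S" by (simp add: coordinate_space_def)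
    next
      fix v :: "nat \<Rightarrow> 'k" assume "v \<in> coordinate_space ?S"
      then have z: "v j = 0" if "\<not> (j < 2 * s \<and> even j)" for j
        using that S unfolding coordinate_space_def by blast
      have "A v j = \<iota> * v j" for j
        using z[of j] n(2) by (cases "j < 2 * s \<and> even j") (auto simp: A_def \<alpha>_def)
      then show "v \<in> FS.block_space a b r (\<iota>, 0)"
        using r by (simp add: FS.block_space_def scale_fun_def fun_eq_iff)
    qed
    moreover have "card ?S = s" by (simp add: card_image inj_on_def)
    ultimately show ?thesis using dim_coordinate_space[of ?S] by simp
  qed
  moreover have "map (\<lambda>p. FS.dim (FS.block_space a b r p)) xs = l"
    using dims m by (metis (no_types, lifting) map_cong)
  ultimately show thesis using that r(1) by blast
qed

end

section \<open>Representations in coordinates\<close>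

text \<open>A linear isomorphism from the range of \<open>truncate n\<close> to \<open>V\<close>,
  with \<psi> extended to all sequences by ignoring the entries from \<open>n\<close> on. Linearity
  is demanded of \<psi> and follows for \<phi> on the carrier.\<close>

definition coordinates :: "nat \<Rightarrow> ('k::field, 'v) module \<Rightarrow> ((nat \<Rightarrow> 'k) \<Rightarrow> 'v) \<Rightarrow> ('v \<Rightarrow> nat \<Rightarrow> 'k) \<Rightarrow> bool" where
  "coordinates n V \<psi> \<phi> \<longleftrightarrow>
    (\<forall>f. \<psi> f \<in> carrier V) \<and>
    (\<forall>f g. \<psi> (f + g) = \<psi> f \<oplus>\<^bsub>V\<^esub> \<psi> g) \<and> (\<forall>c f. \<psi> (scale_fun c f) = c \<odot>\<^bsub>V\<^esub> \<psi> f) \<and>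
    (\<forall>v\<in>carrier V. \<psi> (\<phi> v) = v) \<and> (\<forall>f. \<phi> (\<psi> f) = truncate n f)"

lemma exists_coordinates:
  fixes V :: "('k::field, 'v) module"
  assumes "has_dim class_ring n V"
  obtains \<psi> \<phi> where "coordinates n V \<psi> \<phi>"
proof -
  interpret vectorspace "class_ring :: 'k ring" V
    using assms by (simp add: has_dim_def)
  obtain B where B: "finite B" "basis B"
    using finite_basis_exists assms by (auto simp: has_dim_def)
  have BV: "B \<subseteq> carrier V" using B(2) by (simp add: basis_def)
  have card: "card B = n"
    using dim_basis[OF B] assms by (simp add: has_dim_def)
  obtain h where h: "bij_betw h B {0..<n}"
    using ex_bij_betw_finite_nat[OF B(1)] card by blast
  define \<psi> where "\<psi> f = lincomb (\<lambda>v. f (h v)) B" for f :: "nat \<Rightarrow> 'k"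
  have unique: "\<exists>!c. c \<in> B \<rightarrow>\<^sub>E UNIV \<and> lincomb c B = v" if "v \<in> carrier V" for v
    using basis_criterion[OF B(1) BV] B(2) that by simp
  define coef where "coef v = (THE c. c \<in> B \<rightarrow>\<^sub>E UNIV \<and> lincomb c B = v)" for v
  have coef: "coef v \<in> B \<rightarrow>\<^sub>E UNIV" "lincomb (coef v) B = v" if "v \<in> carrier V" for v
    unfolding coef_def using theI'[OF unique[OF that]] by blast+
  define \<phi> where "\<phi> v = (\<lambda>i. if i < n then coef v (inv_into B h i) else 0)" for v
  have cong: "lincomb c B = lincomb c' B" if "\<And>v. v \<in> B \<Longrightarrow> c v = c' v" for c c' :: "'v \<Rightarrow> 'k"
    unfolding lincomb_def using that BV by (intro finsum_cong') auto
  have \<psi>: "\<psi> f \<in> carrier V" for f using BV by (simp add: \<psi>_def)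
  show thesis
  proof (rule that[of \<psi> \<phi>], unfold coordinates_def, intro conjI allI ballI)
    show "\<psi> f \<in> carrier V" for f by (rule \<psi>)
    show "\<psi> (f + g) = \<psi> f \<oplus>\<^bsub>V\<^esub> \<psi> g" for f g
      using lincomb_sum[OF B(1) BV, of "\<lambda>v. f (h v)" "\<lambda>v. g (h v)"] by (simp add: \<psi>_def)
    show "\<psi> (scale_fun c f) = c \<odot>\<^bsub>V\<^esub> \<psi> f" for c f
      using lincomb_smult[OF BV, of "\<lambda>v. f (h v)" c] by (simp add: \<psi>_def scale_fun_def)
    show "\<psi> (\<phi> v) = v" if v: "v \<in> carrier V" for v
    proof -
      have "\<psi> (\<phi> v) = lincomb (coef v) B"
        unfolding \<psi>_def
        by (rule cong) (use h bij_betw_inv_into_left[OF h] bij_betwE[OF h] in \<open>auto simp: \<phi>_def\<close>)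
      then show ?thesis using coef[OF v] by simp
    qed
    show "\<phi> (\<psi> f) = truncate n f" for f
    proof -
      have "coef (\<psi> f) = restrict (\<lambda>v. f (h v)) B"
      proof -
        have "restrict (\<lambda>v. f (h v)) B \<in> B \<rightarrow>\<^sub>E UNIV" by simp
        moreover have "lincomb (restrict (\<lambda>v. f (h v)) B) B = \<psi> f"
          unfolding \<psi>_def by (rule cong) simp
        ultimately show ?thesis using unique[OF \<psi>[of f]] coef[OF \<psi>[of f]] by blast
      qed
      moreover have "inv_into B h i \<in> B" "h (inv_into B h i) = i" if "i < n" for i
        using bij_betw_inv_into_right[OF h] bij_betwE[OF bij_betw_inv_into[OF h]] that by auto
      ultimately show ?thesis by (simp add: \<phi>_def truncate_def fun_eq_iff)
    qed
  qed
qed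

lemma coordinatesD:
  assumes "coordinates n V \<psi> \<phi>"
  shows "\<psi> f \<in> carrier V" "\<psi> (f + g) = \<psi> f \<oplus>\<^bsub>V\<^esub> \<psi> g" "\<psi> (scale_fun c f) = c \<odot>\<^bsub>V\<^esub> \<psi> f"
    "v \<in> carrier V \<Longrightarrow> \<psi> (\<phi> v) = v" "\<phi> (\<psi> f) = truncate n f"
  using assms by (auto simp: coordinates_def)

lemma truncate_simps:
  "truncate n (truncate n f) = truncate n f" "truncate n (f + g) = truncate n f + truncate n g"
  "truncate n (scale_fun c f) = scale_fun c (truncate n f)"
  by (simp_all add: truncate_def scale_fun_def fun_eq_iff)

lemma coordinates_inverse:
  assumes C: "coordinates n V \<psi> \<phi>"
  shows "\<psi> (truncate n f) = \<psi> f"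
    "v \<in> carrier V \<Longrightarrow> truncate n (\<phi> v) = \<phi> v"
    "v \<in> carrier V \<Longrightarrow> w \<in> carrier V \<Longrightarrow> \<phi> (v \<oplus>\<^bsub>V\<^esub> w) = \<phi> v + \<phi> w"
    "v \<in> carrier V \<Longrightarrow> \<phi> (c \<odot>\<^bsub>V\<^esub> v) = scale_fun c (\<phi> v)"
proof -
  note D = coordinatesD[OF C]
  show "\<psi> (truncate n f) = \<psi> f" using D(1,4,5) by metis
  have T: "truncate n (\<phi> v) = \<phi> v" if "v \<in> carrier V" for v using D(4)[OF that] D(5) by metis
  then show "v \<in> carrier V \<Longrightarrow> truncate n (\<phi> v) = \<phi> v" .
  show "\<phi> (v \<oplus>\<^bsub>V\<^esub> w) = \<phi> v + \<phi> w" if "v \<in> carrier V" "w \<in> carrier V"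
    using D(2)[of "\<phi> v" "\<phi> w"] D(5)[of "\<phi> v + \<phi> w"] D(4) T that by (simp add: truncate_simps)
  show "\<phi> (c \<odot>\<^bsub>V\<^esub> v) = scale_fun c (\<phi> v)" if "v \<in> carrier V"
    using D(3)[of c "\<phi> v"] D(5)[of "scale_fun c (\<phi> v)"] D(4) T that by (simp add: truncate_simps)
qed

section \<open>Passing between representations and linear actions\<close>

lemma module_hom_class_ring_iff:
  "f \<in> LinearCombinations.module_hom (class_ring :: 'k::field ring) V W \<longleftrightarrow>
    f \<in> carrier V \<rightarrow> carrier W \<and>
    (\<forall>x\<in>carrier V. \<forall>y\<in>carrier V. f (x \<oplus>\<^bsub>V\<^esub> y) = f x \<oplus>\<^bsub>W\<^esub> f y) \<and>
    (\<forall>c. \<forall>x\<in>carrier V. f (c \<odot>\<^bsub>V\<^esub> x) = c \<odot>\<^bsub>W\<^esub> f x)"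
  by (auto simp: LinearCombinations.module_hom_def)

lemma hom_GL_iff:
  "\<rho> \<in> hom G (GL K V) \<longleftrightarrow>
    (\<forall>g\<in>carrier G. \<rho> g \<in> LinearCombinations.module_hom K V V \<inter> Bij (carrier V)) \<and>
    (\<forall>g\<in>carrier G. \<forall>h\<in>carrier G. \<rho> (g \<otimes>\<^bsub>G\<^esub> h) = compose (carrier V) (\<rho> g) (\<rho> h))"
  by (auto simp: hom_def GL_def BijGroup_def Pi_def)

lemma linear_action_of_rep:
  fixes V :: "('k::field, 'v) module"
  assumes G: "group G" and C: "coordinates n V \<psi> \<phi>" and \<rho>: "\<rho> \<in> hom G (GL class_ring V)"
  shows "FS.linear_action G (truncate n) (\<lambda>g f. \<phi> (\<rho> g (\<psi> f)))"
proof -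
  interpret group G by (rule G)
  note D = coordinatesD[OF C] and I = coordinates_inverse[OF C]
  have hom: "\<rho> g \<in> LinearCombinations.module_hom class_ring V V" "\<rho> g \<in> Bij (carrier V)" if "g \<in> carrier G" for g
    using \<rho> that by (simp_all add: hom_GL_iff)
  have mult: "\<rho> (g \<otimes>\<^bsub>G\<^esub> h) v = \<rho> g (\<rho> h v)" if "g \<in> carrier G" "h \<in> carrier G" "v \<in> carrier V" for g h v
    using \<rho> that by (simp add: hom_GL_iff compose_def)
  have mem: "\<rho> g v \<in> carrier V" if "g \<in> carrier G" "v \<in> carrier V" for g v
    using hom(1)[OF that(1)] that(2) by (auto simp: module_hom_class_ring_iff)
  \<comment> \<open>The image of the unit is idempotent and injective, hence the identity on the
    carrier.\<close>
  have one: "\<rho> \<one>\<^bsub>G\<^esub> v = v" if v: "v \<in> carrier V" for v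
  proof -
    have "inj_on (\<rho> \<one>\<^bsub>G\<^esub>) (carrier V)" using hom(2)[OF one_closed] by (simp add: Bij_def bij_betw_def)
    moreover have "\<rho> \<one>\<^bsub>G\<^esub> (\<rho> \<one>\<^bsub>G\<^esub> v) = \<rho> \<one>\<^bsub>G\<^esub> v"
      using mult[OF one_closed one_closed v] by simp
    ultimately show ?thesis using mem[OF one_closed v] v by (meson inj_onD)
  qed
  show ?thesis
    unfolding FS.linear_action_def
  proof (intro conjI ballI allI)
    show "FS.lin (\<lambda>f. \<phi> (\<rho> g (\<psi> f)))" if g: "g \<in> carrier G" for g
      using hom(1)[OF g] mem[OF g] D I unfolding FS.lin_iff module_hom_class_ring_iff by simp
    show "\<phi> (\<rho> \<one>\<^bsub>G\<^esub> (\<psi> v)) = truncate n v" for v using one D by simp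
    show "\<phi> (\<rho> (g \<otimes>\<^bsub>G\<^esub> h) (\<psi> v)) = \<phi> (\<rho> g (\<psi> (\<phi> (\<rho> h (\<psi> v)))))"
      if "g \<in> carrier G" "h \<in> carrier G" for g h v
      using mult[OF that] D mem[OF that(2)] by simp
  qed
qed

text \<open>The action is conjugated by the coordinates, the inverse group element supplying the
  inverse map. The operators are restricted to the carrier because \<open>Bij\<close> contains only
  extensional functions.\<close>

lemma rep_of_linear_action:
  fixes V :: "('k::field, 'v) module"
  assumes G: "group G" and V: "has_dim class_ring n V" and C: "coordinates n V \<psi> \<phi>"
    and r: "FS.linear_action G (truncate n) r"
  shows "(V, \<lambda>g. \<lambda>v\<in>carrier V. \<psi> (r g (\<phi> v))) \<in> reps class_ring G n"
proof -
  interpret group G by (rule G)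
  interpret vectorspace "class_ring :: 'k ring" V using V by (simp add: has_dim_def)
  note D = coordinatesD[OF C] and I = coordinates_inverse[OF C]
  note R = FS.linear_actionD[OF r] and S = FS.linear_action_simps[OF r] and U = FS.linear_action_unit[OF G r]
  let ?\<rho> = "\<lambda>g. \<lambda>v\<in>carrier V. \<psi> (r g (\<phi> v))"
  have mult: "\<psi> (r (g \<otimes>\<^bsub>G\<^esub> h) (\<phi> v)) = \<psi> (r g (\<phi> (\<psi> (r h (\<phi> v)))))"
    if "g \<in> carrier G" "h \<in> carrier G" "v \<in> carrier V" for g h v
    using that R(3) D(5) U(2) by simp
  have inv: "?\<rho> g (?\<rho> h v) = v" if "g \<in> carrier G" "h \<in> carrier G" "g \<otimes>\<^bsub>G\<^esub> h = \<one>\<^bsub>G\<^esub>" "v \<in> carrier V" for g h v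
    using mult[OF that(1,2,4)] that R(2) D I by simp
  have "?\<rho> \<in> hom G (GL class_ring V)"
    unfolding hom_GL_iff
  proof (intro conjI ballI IntI)
    fix g assume g: "g \<in> carrier G"
    show "?\<rho> g \<in> LinearCombinations.module_hom class_ring V V"
      using S[OF g] D I by (simp add: module_hom_class_ring_iff)
    have "bij_betw (?\<rho> g) (carrier V) (carrier V)"
      by (rule bij_betw_byWitness[where f' = "?\<rho> (inv\<^bsub>G\<^esub> g)"])
        (use inv[of g "inv\<^bsub>G\<^esub> g"] inv[of "inv\<^bsub>G\<^esub> g" g] g D(1) in auto)
    then show "?\<rho> g \<in> Bij (carrier V)" by (simp add: Bij_def)
    show "?\<rho> (g \<otimes>\<^bsub>G\<^esub> h) = compose (carrier V) (?\<rho> g) (?\<rho> h)" if h: "h \<in> carrier G" for h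
      using mult[OF g h] D(1) by (auto simp: compose_def restrict_def fun_eq_iff)
  qed
  then show ?thesis using V by (simp add: reps_def)
qed

lemma rep_iso_iff_action_iso:
  fixes V :: "('k::field, 'v) module" and W :: "('k, 'w) module"
  assumes G: "group G" and CV: "coordinates n V \<psi> \<phi>" and CW: "coordinates n W \<psi>' \<phi>'"
    and \<rho>: "\<rho> \<in> hom G (GL class_ring V)" and \<sigma>: "\<sigma> \<in> hom G (GL class_ring W)"
  shows "(\<exists>T. rep_iso class_ring G T (V, \<rho>) (W, \<sigma>)) \<longleftrightarrow>
    (\<exists>T S. FS.action_iso G (truncate n) (\<lambda>g f. \<phi> (\<rho> g (\<psi> f))) (\<lambda>g f. \<phi>' (\<sigma> g (\<psi>' f))) T S)"
proof -
  note D = coordinatesD[OF CV] and I = coordinates_inverse[OF CV]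
  note D' = coordinatesD[OF CW] and I' = coordinates_inverse[OF CW]
  let ?r = "\<lambda>g f. \<phi> (\<rho> g (\<psi> f))" and ?s = "\<lambda>g f. \<phi>' (\<sigma> g (\<psi>' f))"
  have mem: "\<rho> g v \<in> carrier V" if "g \<in> carrier G" "v \<in> carrier V" for g v
    using \<rho> that by (auto simp: hom_GL_iff module_hom_class_ring_iff)
  have mem': "\<sigma> g v \<in> carrier W" if "g \<in> carrier G" "v \<in> carrier W" for g v
    using \<sigma> that by (auto simp: hom_GL_iff module_hom_class_ring_iff)
  show ?thesis
  proof
    assume "\<exists>T. rep_iso class_ring G T (V, \<rho>) (W, \<sigma>)"
    then obtain T where T: "T \<in> carrier V \<rightarrow> carrier W"
      "\<And>x y. x \<in> carrier V \<Longrightarrow> y \<in> carrier V \<Longrightarrow> T (x \<oplus>\<^bsub>V\<^esub> y) = T x \<oplus>\<^bsub>W\<^esub> T y"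
      "\<And>c x. x \<in> carrier V \<Longrightarrow> T (c \<odot>\<^bsub>V\<^esub> x) = c \<odot>\<^bsub>W\<^esub> T x"
      and bij: "bij_betw T (carrier V) (carrier W)"
      and tw: "\<And>g v. g \<in> carrier G \<Longrightarrow> v \<in> carrier V \<Longrightarrow> T (\<rho> g v) = \<sigma> g (T v)"
      by (auto simp: rep_iso_def module_hom_class_ring_iff)
    define S where "S = inv_into (carrier V) T"
    have TW: "T x \<in> carrier W" if "x \<in> carrier V" for x using T(1) that by blast
    have SV: "S y \<in> carrier V" if "y \<in> carrier W" for y
      using bij_betwE[OF bij_betw_inv_into[OF bij]] that by (simp add: S_def)
    have ST: "S (T x) = x" if "x \<in> carrier V" for x using bij_betw_inv_into_left[OF bij that] by (simp add: S_def)
    have TS: "T (S y) = y" if "y \<in> carrier W" for y using bij_betw_inv_into_right[OF bij that] by (simp add: S_def)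
    have linT: "FS.lin (\<lambda>f. \<phi>' (T (\<psi> f)))"
      unfolding FS.lin_iff using T D D' I' TW by simp
    have "FS.action_iso G (truncate n) ?r ?s (\<lambda>f. \<phi>' (T (\<psi> f))) (\<lambda>f. \<phi> (S (\<psi>' f)))"
      unfolding FS.action_iso_def
    proof (intro conjI ballI allI linT)
      show "\<phi> (S (\<psi>' (\<phi>' (T (\<psi> f))))) = truncate n f" for f using D D' TW ST by simp
      show "\<phi>' (T (\<psi> (\<phi> (S (\<psi>' f))))) = truncate n f" for f using D D' SV TS by simp
      show "\<phi>' (T (\<psi> (?r g f))) = ?s g (\<phi>' (T (\<psi> f)))" if "g \<in> carrier G" for g f
        using D D' TW tw mem that by simp
      show "FS.lin (\<lambda>f. \<phi> (S (\<psi>' f)))"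
      proof -
        have "S (x \<oplus>\<^bsub>W\<^esub> y) = S x \<oplus>\<^bsub>V\<^esub> S y" if xy: "x \<in> carrier W" "y \<in> carrier W" for x y
        proof -
          have "S x \<oplus>\<^bsub>V\<^esub> S y \<in> carrier V"
            using D(2)[of "\<phi> (S x)" "\<phi> (S y)", symmetric] D(1) D(4)[OF SV] xy by simp
          then show ?thesis using ST[of "S x \<oplus>\<^bsub>V\<^esub> S y"] T(2) SV TS xy by simp
        qed
        moreover have "S (c \<odot>\<^bsub>W\<^esub> x) = c \<odot>\<^bsub>V\<^esub> S x" if x: "x \<in> carrier W" for c x
        proof -
          have "c \<odot>\<^bsub>V\<^esub> S x \<in> carrier V"
            using D(3)[of c "\<phi> (S x)", symmetric] D(1) D(4)[OF SV] x by simp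
          then show ?thesis using ST[of "c \<odot>\<^bsub>V\<^esub> S x"] T(3) SV TS x by simp
        qed
        ultimately show ?thesis unfolding FS.lin_iff using D' I D SV by simp
      qed
    qed
    then show "\<exists>T S. FS.action_iso G (truncate n) ?r ?s T S" by blast
  next
    assume "\<exists>T S. FS.action_iso G (truncate n) ?r ?s T S"
    then obtain T S where TS: "FS.action_iso G (truncate n) ?r ?s T S" by blast
    note A = FS.action_isoD[OF TS]
    let ?T = "\<lambda>v. \<psi>' (T (\<phi> v))" and ?S = "\<lambda>w. \<psi> (S (\<phi>' w))"
    \<comment> \<open>Both sides are the composite of \<open>T\<close>, \<open>S\<close> and
      \<open>T\<close>, bracketed in two ways.\<close>
    have TE: "truncate n (T f) = T (truncate n f)" for f using A(3,4) by metis
    have SE: "truncate n (S f) = S (truncate n f)" for f using A(3,4) by metis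
    have "bij_betw ?T (carrier V) (carrier W)"
      by (rule bij_betw_byWitness[where f' = ?S]) (use D D' I I' A TE SE in auto)
    moreover have "?T \<in> LinearCombinations.module_hom class_ring V W"
      using D' I FS.lin_add[OF A(1)] FS.lin_scale[OF A(1)] by (simp add: module_hom_class_ring_iff)
    moreover have "?T (\<rho> g v) = \<sigma> g (?T v)" if "g \<in> carrier G" "v \<in> carrier V" for g v
    proof -
      have "T (\<phi> (\<rho> g v)) = \<phi>' (\<sigma> g (\<psi>' (T (\<phi> v))))"
        using A(5)[OF that(1), of "\<phi> v"] D(4)[OF that(2)] by simp
      then show ?thesis using D' mem'[OF that(1)] by simp
    qed
    ultimately show "\<exists>T. rep_iso class_ring G T (V, \<rho>) (W, \<sigma>)"
      unfolding rep_iso_def by blast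
  qed
qed

text \<open>The equivalence classes are the nonempty fibres of \<open>f\<close>.\<close>

lemma card_quotient_invariant:
  assumes "\<And>x y. x \<in> X \<Longrightarrow> y \<in> X \<Longrightarrow> (x, y) \<in> R \<longleftrightarrow> f x = f y" "R \<subseteq> X \<times> X"
  shows "card (X // R) = card (f ` X)"
proof -
  let ?fib = "\<lambda>y. {x \<in> X. f x = y}"
  have "R `` {x} = ?fib (f x)" if "x \<in> X" for x
    using assms that by auto
  then have "X // R = ?fib ` f ` X"
    by (auto simp: quotient_def image_iff)
  moreover have "inj_on ?fib (f ` X)"
    by (rule inj_onI) auto
  ultimately show ?thesis by (simp add: card_image)
qed

text \<open>Here \<open>key\<close> is a complete invariant of actions on sequences. Coordinates are
  chosen for every space at once, and their choice affects an action only up to isomorphism. A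
  single space \<open>V\<close> in the universe suffices for surjectivity, since every action on
  sequences can be transported to it.\<close>

lemma card_rep_classes:
  fixes key :: "('g \<Rightarrow> (nat \<Rightarrow> 'k::field) \<Rightarrow> nat \<Rightarrow> 'k) \<Rightarrow> 'i"
  assumes G: "group G"
    and V: "has_dim class_ring n (V :: ('k, 'v) module)"
    and key: "\<And>r s. FS.linear_action G (truncate n) r \<Longrightarrow> FS.linear_action G (truncate n) s \<Longrightarrow>
      (\<exists>T S. FS.action_iso G (truncate n) r s T S) \<longleftrightarrow> key r = key s"
  shows "card (rep_classes TYPE('v) (class_ring :: 'k ring) G n) =
    card (key ` {r. FS.linear_action G (truncate n) r})"
proof -
  have "\<forall>V :: ('k, 'v) module. \<exists>p. has_dim class_ring n V \<longrightarrow> coordinates n V (fst p) (snd p)"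
    using exists_coordinates by (metis fst_conv snd_conv)
  then obtain p where p: "\<And>V :: ('k, 'v) module. has_dim class_ring n V \<Longrightarrow> coordinates n V (fst (p V)) (snd (p V))"
    by metis
  define act where "act = (\<lambda>(V :: ('k, 'v) module, \<rho> :: 'g \<Rightarrow> 'v \<Rightarrow> 'v) g f. snd (p V) (\<rho> g (fst (p V) f)))"
  let ?X = "reps class_ring G n :: (('k, 'v) module \<times> ('g \<Rightarrow> 'v \<Rightarrow> 'v)) set"
  have act: "FS.linear_action G (truncate n) (act x)" if "x \<in> ?X" for x
    using that linear_action_of_rep[OF G p] by (auto simp: reps_def act_def)
  have "card (?X // rep_rel class_ring G n) = card ((key \<circ> act) ` ?X)"
  proof (rule card_quotient_invariant)
    show "rep_rel class_ring G n \<subseteq> ?X \<times> ?X" by (auto simp: rep_rel_def)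
    fix x y assume xy: "x \<in> ?X" "y \<in> ?X"
    obtain V \<rho> W \<sigma> where *: "x = (V, \<rho>)" "y = (W, \<sigma>)" by fastforce
    have "(x, y) \<in> rep_rel class_ring G n \<longleftrightarrow> (\<exists>T. rep_iso class_ring G T x y)"
      using xy by (simp add: rep_rel_def)
    also have "\<dots> \<longleftrightarrow> (\<exists>T S. FS.action_iso G (truncate n) (act x) (act y) T S)"
      using xy rep_iso_iff_action_iso[OF G p p] unfolding * by (simp add: reps_def act_def)
    also have "\<dots> \<longleftrightarrow> (key \<circ> act) x = (key \<circ> act) y"
      using key[OF act act] xy by simp
    finally show "(x, y) \<in> rep_rel class_ring G n \<longleftrightarrow> (key \<circ> act) x = (key \<circ> act) y" .
  qed
  moreover have "(key \<circ> act) ` ?X = key ` {r. FS.linear_action G (truncate n) r}"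
  proof
    show "(key \<circ> act) ` ?X \<subseteq> key ` {r. FS.linear_action G (truncate n) r}" using act by auto
    show "key ` {r. FS.linear_action G (truncate n) r} \<subseteq> (key \<circ> act) ` ?X"
    proof
      fix i assume "i \<in> key ` {r. FS.linear_action G (truncate n) r}"
      then obtain r where r: "FS.linear_action G (truncate n) r" "i = key r" by blast
      note C = p[OF V]
      let ?x = "(V, \<lambda>g. \<lambda>v\<in>carrier V. fst (p V) (r g (snd (p V) v)))"
      have x: "?x \<in> ?X" by (rule rep_of_linear_action[OF G V C r(1)])
      have eq: "act ?x g f = r g f" if "g \<in> carrier G" for g f
        using coordinatesD[OF C] FS.linear_action_unit[OF G r(1) that] by (simp add: act_def)
      \<comment> \<open>The transported action agrees with \<open>r\<close> only for elements of the
        group, so the two are compared by an isomorphism and not by equality.\<close>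
      have "FS.action_iso G (truncate n) (act ?x) r (truncate n) (truncate n)"
        unfolding FS.action_iso_def
        using eq FS.linear_action_unit[OF G r(1)] by (simp add: FS.lin_iff truncate_simps)
      then have "key (act ?x) = key r" using key[OF act[OF x] r(1)] by blast
      then show "i \<in> (key \<circ> act) ` ?X"
        unfolding r(2) by (intro image_eqI[OF _ x]) simp
    qed
  qed
  ultimately show ?thesis by (simp add: rep_classes_def)
qed

section \<open>Counting\<close>

lemma two_neq_zero_if_CHAR: "CHAR('k::field) \<noteq> 2 \<Longrightarrow> (2::'k) \<noteq> 0"
proof
  assume "CHAR('k) \<noteq> 2" "(2::'k) = 0"
  then have "CHAR('k) dvd 2" using of_nat_eq_0_iff_char_dvd[of 2, where ?'a = 'k] by simp
  then have "CHAR('k) = 1 \<or> CHAR('k) = 2" using prime_nat_iff two_is_prime_nat by blast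
  then show False using \<open>CHAR('k) \<noteq> 2\<close> CHAR_not_1 by simp
qed

lemma card_abelian_reps:
  fixes G :: "('g, 'c) monoid_scheme"
  assumes G: "comm_group G" "Coset.order G = 8"
    and two: "(2::'a::alg_closed_field) \<noteq> 0"
    and V: "has_dim class_ring n (V :: ('a, 'v) module)"
  shows "card (rep_classes TYPE('v) (class_ring :: 'a ring) G n) = (n + 7) choose 7"
proof -
  interpret comm_group G by (rule G(1))
  let ?C = "characters G (carrier G) :: ('g \<Rightarrow> 'a) set"
  have sq: "\<exists>y. y * y = (x::'a)" for x
    using nth_root_exists[of 2 x] by (auto simp: power2_eq_square)
  have dual: "dual_orthogonal TYPE('a) G (carrier G)"
    by (rule dual_orthogonal_2_group[OF two sq, of 3]) (simp add: G(2))
  have card8: "card (carrier G) = 8" using G(2) by (simp add: Coset.order_def)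
  have "(2::'a) * (2 * 2) \<noteq> 0" using two by (simp only: mult_eq_0_iff) simp
  then have ord: "of_nat (card (carrier G)) \<noteq> (0::'a)" by (simp add: card8)
  obtain xs where xs: "distinct xs" "set xs = ?C"
    using dual finite_distinct_list unfolding dual_orthogonal_def by blast
  have len: "length xs = 8"
    using dual distinct_card[OF xs(1)] by (simp add: xs(2) dual_orthogonal_def card8)
  note F = finite_imageI[OF finite_lessThan] range_truncate_span
  let ?inv = "\<lambda>r. map (\<lambda>\<chi>. FS.dim (FS.weight_space G r \<chi>)) xs"
  have "card (rep_classes TYPE('v) (class_ring :: 'a ring) G n) =
      card (?inv ` {r. FS.linear_action G (truncate n) r})"
  proof (rule card_rep_classes[OF is_group V])
    fix r s :: "'g \<Rightarrow> (nat \<Rightarrow> 'a) \<Rightarrow> nat \<Rightarrow> 'a"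
    assume "FS.linear_action G (truncate n) r" "FS.linear_action G (truncate n) s"
    from FS.abelian_action_iso_iff[OF G(1) dual ord this F]
    show "(\<exists>T S. FS.action_iso G (truncate n) r s T S) \<longleftrightarrow> ?inv r = ?inv s"
      by (simp add: xs(2))
  qed
  also have "?inv ` {r. FS.linear_action G (truncate n) r} = {l. length l = 8 \<and> sum_list l = n}"
  proof (intro equalityI subsetI)
    fix l assume "l \<in> ?inv ` {r. FS.linear_action G (truncate n) r}"
    then obtain r where r: "FS.linear_action G (truncate n) r" "l = ?inv r" by blast
    have "sum_list l = (\<Sum>\<chi>\<in>?C. FS.dim (FS.weight_space G r \<chi>))"
      unfolding r(2) by (simp add: sum_list_distinct_conv_sum_set[OF xs(1)] xs(2))
    also have "\<dots> = FS.dim (range (truncate n :: (nat \<Rightarrow> 'a) \<Rightarrow> _))"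
      by (rule FS.dim_projection_system[OF FS.weight_projection_system[OF G(1) dual ord r(1)] F, symmetric])
    finally show "l \<in> {l. length l = 8 \<and> sum_list l = n}"
      using r(2) len by (simp add: dim_range_truncate)
  next
    fix l assume "l \<in> {l. length l = 8 \<and> sum_list l = n}"
    then have "length l = length xs" "sum_list l = n" using len by simp_all
    from exists_abelian_action[OF is_group xs this]
    show "l \<in> ?inv ` {r. FS.linear_action G (truncate n) r}" by blast
  qed
  \<comment> \<open>Stars and bars: 8 multiplicities are separated by 7 bars.\<close>
  also have "card \<dots> = (n + 7) choose n" using card_length_sum_list[of 8 n] by (simp add: add.commute)
  also have "\<dots> = (n + 7) choose 7" using binomial_symmetric[of n "n + 7"] by simp
  finally show ?thesis .
qed

lemma card_nonabelian_reps:
  fixes G :: "('g, 'c) monoid_scheme"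
  assumes G: "group G" "Coset.order G = 8" "\<not> comm_group G"
    and two: "(2::'a::alg_closed_field) \<noteq> 0"
    and V: "has_dim class_ring n (V :: ('a, 'v) module)"
  shows "card (rep_classes TYPE('v) (class_ring :: 'a ring) G n) =
    (\<Sum>s = 0..n div 2. (n - 2 * s + 3) choose 3)"
proof -
  obtain a b where "nonabelian_presentation G a b"
    using group.nonabelian_order_8[OF G] by blast
  then interpret nonabelian_presentation G a b .
  obtain \<iota> :: 'a where iota: "\<iota> * \<iota> = -1"
    using nth_root_exists[of 2 "-1 :: 'a"] by (auto simp: power2_eq_square)
  define xs :: "('a \<times> 'a) list" where "xs = [(1, 1), (1, -1), (-1, 1), (-1, -1)]"
  note F = finite_imageI[OF finite_lessThan] range_truncate_span
  let ?d = "\<lambda>r p. FS.dim (FS.block_space a b r p)"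
  let ?inv = "\<lambda>r. (?d r (\<iota>, 0), map (?d r) xs)"
  have "card (rep_classes TYPE('v) (class_ring :: 'a ring) G n) =
      card (?inv ` {r. FS.linear_action G (truncate n) r})"
  proof (rule card_rep_classes[OF is_group V])
    fix r s :: "'g \<Rightarrow> (nat \<Rightarrow> 'a) \<Rightarrow> nat \<Rightarrow> 'a"
    assume "FS.linear_action G (truncate n) r" "FS.linear_action G (truncate n) s"
    from nonabelian_action_iso_iff[OF FS.linear_endo_axioms this iota two F]
    show "(\<exists>T S. FS.action_iso G (truncate n) r s T S) \<longleftrightarrow> ?inv r = ?inv s"
      by (auto simp: xs_def)
  qed
  \<comment> \<open>The first component counts the two-dimensional constituents, each of which uses
    up one dimension for \<iota> and one for -\<iota>. The bound \<open>n div 2\<close> keeps the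
    natural subtraction exact.\<close>
  also have "?inv ` {r. FS.linear_action G (truncate n) r} =
    (SIGMA s:{0..n div 2}. {l. length l = 4 \<and> sum_list l = n - 2 * s})"
  proof (intro equalityI subsetI)
    fix p assume "p \<in> ?inv ` {r. FS.linear_action G (truncate n) r}"
    then obtain r where r: "FS.linear_action G (truncate n) r" "p = ?inv r" by blast
    have "n = sum_list (map (?d r) xs) + 2 * ?d r (\<iota>, 0)"
      using dim_range_blocks[OF FS.linear_endo_axioms r(1) iota two F]
      by (simp add: dim_range_truncate xs_def)
    then show "p \<in> (SIGMA s:{0..n div 2}. {l. length l = 4 \<and> sum_list l = n - 2 * s})"
      using r(2) by (auto simp: xs_def)
  next
    fix p assume "p \<in> (SIGMA s:{0..n div 2}. {l. length l = 4 \<and> sum_list l = n - 2 * s})"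
    then obtain s l where p: "p = (s, l)" "length l = 4" "sum_list l + 2 * s = n" by auto
    obtain r where "FS.linear_action G (truncate n) r" "map (?d r) xs = l" "?d r (\<iota>, 0) = s"
      using exists_nonabelian_action[OF iota two xs_def p(2,3)] by blast
    then show "p \<in> ?inv ` {r. FS.linear_action G (truncate n) r}" using p(1) by blast
  qed
  also have "card \<dots> = (\<Sum>s\<in>{0..n div 2}. card {l :: nat list. length l = 4 \<and> sum_list l = n - 2 * s})"
  proof (rule card_SigmaI)
    show "\<forall>s\<in>{0..n div 2}. finite {l :: nat list. length l = 4 \<and> sum_list l = n - 2 * s}"
    proof
      fix s
      have "{l :: nat list. length l = 4 \<and> sum_list l = n - 2 * s} \<subseteq> {l. set l \<subseteq> {..n} \<and> length l = 4}"
        using member_le_sum_list by fastforce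
      then show "finite {l :: nat list. length l = 4 \<and> sum_list l = n - 2 * s}"
        using finite_lists_length_eq[of "{..n}" 4] finite_subset by blast
    qed
  qed simp
  also have "\<dots> = (\<Sum>s = 0..n div 2. (n - 2 * s + 3) choose 3)"
  proof (rule sum.cong[OF refl])
    have "card {l :: nat list. length l = 4 \<and> sum_list l = N} = (N + 3) choose 3" for N
      using card_length_sum_list[of 4 N] binomial_symmetric[of N "N + 3"] by (simp add: add.commute)
    then show "card {l :: nat list. length l = 4 \<and> sum_list l = n - 2 * s} = (n - 2 * s + 3) choose 3" for s .
  qed
  finally show ?thesis .
qed

theorem theorem1p1:
  fixes G :: "('g, 'c) monoid_scheme"
    and n :: nat
  assumes "group G" and "Coset.order G = 8"
    and "CHAR('a :: alg_closed_field) \<noteq> 2"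
    and "n > 0"
    and "\<exists>V :: ('a, 'v) module. has_dim class_ring n V"
  shows "card (rep_classes TYPE('v) (class_ring :: 'a ring) G n) =
    (if comm_group G then (n + 7) choose 7
     else (\<Sum>s = 0..n div 2. (n - 2 * s + 3) choose 3))"
proof -
  obtain V :: "('a, 'v) module" where V: "has_dim class_ring n V" using assms(5) by blast
  note two = two_neq_zero_if_CHAR[OF assms(3)]
  show ?thesis
    using card_abelian_reps[OF _ assms(2) two V] card_nonabelian_reps[OF assms(1,2) _ two V] by simp
qed

end
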